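(* Let $0\le\alpha<n$ and $b\in BMO(\mathbb{R}^n)$. Let $\Phi$ be a Young function and let $\Psi$ be defined via its inverse by $\Psi^{-1}(t)=\Phi^{-1}(t)t^{-\alpha/n}$ for $t\in(0,\infty)$. If $1<a_{\Phi}\le b_{\Phi}<\infty$ and $1<a_{\Psi}\le b_{\Psi}<\infty$, then $M_{b,\alpha}$ is bounded from $L_{\Phi}(\mathbb{R}^n)$ to $L_{\Psi}(\mathbb{R}^n)$.
   Context: A Young function is a convex, left-continuous $\Phi:[0,\infty)\to[0,\infty]$ with $\lim_{r\to0+}\Phi(r)=\Phi(0)=0$ and $\lim_{r\to\infty}\Phi(r)=\infty$; $\Phi^{-1}(s)=\inf\{r\ge0:\Phi(r)>s\}$. $L_\Phi(\mathbb{R}^n)$ is the Orlicz space with norm $\|f\|_{L_\Phi}=\inf\{\lambda>0:\int\Phi(|f|/\lambda)\le1\}$. For a Young function $\Phi$, $a_\Phi=\inf_{t>0}t\Phi'(t)/\Phi(t)$ and $b_\Phi=\sup_{t>0}t\Phi'(t)/\Phi(t)$. $BMO(\mathbb{R}^n)$ is the space of $b\in L^1_{\rm loc}$ with $\|b\|_\ast=\sup_{x,r>0}|B(x,r)|^{-1}\int_{B(x,r)}|b(y)-b_{B(x,r)}|dy<\infty$, $b_B$ the mean of $b$ on $B$. The commutator of the fractional maximal operator is $M_{b,\alpha}f(x)=\sup_{t>0}|B(x,t)|^{-1+\alpha/n}\int_{B(x,t)}|b(x)-b(y)||f(y)|dy$. *)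

theory Defs
  imports "HOL-Analysis.Analysis"
begin

definition young_function :: "(real \<Rightarrow> ennreal) \<Rightarrow> bool" where
  "young_function \<Phi> \<longleftrightarrow>
     (\<forall>x\<ge>0. \<forall>y\<ge>0. \<forall>u\<in>{0..1}.
        \<Phi> ((1 - u) * x + u * y) \<le> ennreal (1 - u) * \<Phi> x + ennreal u * \<Phi> y)
   \<and> (\<forall>r>0. (\<Phi> \<longlongrightarrow> \<Phi> r) (at_left r))
   \<and> \<Phi> 0 = 0 \<and> (\<Phi> \<longlongrightarrow> 0) (at_right 0)
   \<and> (\<Phi> \<longlongrightarrow> \<infinity>) at_top"

definition young_inv :: "(real \<Rightarrow> ennreal) \<Rightarrow> real \<Rightarrow> real" where
  "young_inv \<Phi> s = Inf {r. 0 \<le> r \<and> \<Phi> r > ennreal s}"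

definition young_deriv :: "(real \<Rightarrow> ennreal) \<Rightarrow> real \<Rightarrow> real" where
  "young_deriv \<Phi> t =
     Lim (at_right t) (\<lambda>s. (enn2real (\<Phi> s) - enn2real (\<Phi> t)) / (s - t))"

definition young_indices_defined :: "(real \<Rightarrow> ennreal) \<Rightarrow> bool" where
  "young_indices_defined \<Phi> \<longleftrightarrow> (\<forall>t>0. 0 < \<Phi> t \<and> \<Phi> t < \<infinity>)"

definition lower_index :: "(real \<Rightarrow> ennreal) \<Rightarrow> ereal" where
  "lower_index \<Phi> =
     (if young_indices_defined \<Phi>
      then (INF t\<in>{0<..}. ereal (t * young_deriv \<Phi> t / enn2real (\<Phi> t)))
      else -\<infinity>)"

definition upper_index :: "(real \<Rightarrow> ennreal) \<Rightarrow> ereal" where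
  "upper_index \<Phi> =
     (if young_indices_defined \<Phi>
      then (SUP t\<in>{0<..}. ereal (t * young_deriv \<Phi> t / enn2real (\<Phi> t)))
      else \<infinity>)"

definition young_ext :: "(real \<Rightarrow> ennreal) \<Rightarrow> ennreal \<Rightarrow> ennreal" where
  "young_ext \<Phi> u = (if u = \<infinity> then \<infinity> else \<Phi> (enn2real u))"

definition luxemburg_norm ::
  "(real \<Rightarrow> ennreal) \<Rightarrow> ('a::euclidean_space \<Rightarrow> ennreal) \<Rightarrow> ennreal" where
  "luxemburg_norm \<Phi> g =
     Inf {ennreal l | l. 0 < l \<and> (\<integral>\<^sup>+ x. young_ext \<Phi> (g x / ennreal l) \<partial>lebesgue) \<le> 1}"

definition orlicz_space :: "(real \<Rightarrow> ennreal) \<Rightarrow> ('a::euclidean_space \<Rightarrow> real) set" where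
  "orlicz_space \<Phi> =
     {f. f \<in> borel_measurable lebesgue \<and> luxemburg_norm \<Phi> (\<lambda>x. ennreal \<bar>f x\<bar>) < \<infinity>}"

definition ball_mean :: "('a::euclidean_space \<Rightarrow> real) \<Rightarrow> 'a set \<Rightarrow> real" where
  "ball_mean b B = (LINT y:B|lebesgue. b y) / measure lebesgue B"

definition BMO :: "('a::euclidean_space \<Rightarrow> real) set" where
  "BMO = {b. b \<in> borel_measurable lebesgue
            \<and> (\<forall>x r. set_integrable lebesgue (ball x r) b)
            \<and> (\<exists>K. \<forall>x. \<forall>r>0.
                 (LINT y:ball x r|lebesgue. \<bar>b y - ball_mean b (ball x r)\<bar>)
                   / measure lebesgue (ball x r) \<le> K)}"

definition frac_max_comm ::
  "('a::euclidean_space \<Rightarrow> real) \<Rightarrow> real \<Rightarrow> ('a \<Rightarrow> real) \<Rightarrow> 'a \<Rightarrow> ennreal" where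
  "frac_max_comm b \<alpha> f x =
     (SUP t\<in>{0<..}.
        ennreal (measure lebesgue (ball x t) powr (\<alpha> / real DIM('a) - 1))
        * (\<integral>\<^sup>+ y\<in>ball x t. ennreal (\<bar>b x - b y\<bar> * \<bar>f y\<bar>) \<partial>lebesgue))"

end

theory Submission
  imports Defs
begin

text \<open>
  On a ball of centre \<open>x\<close> and radius \<open>t\<close>, Hoelder's inequality and the John-Nirenberg theorem bound
  the average in the definition of the commutator by \<open>(2 |b(x) - b_B| + c) A(x,t)\<close>, where
  \<open>A(x,t) = |B|^(alpha/n) (avg_B |f|^s)^(1/s)\<close> and \<open>s > 1\<close> is smaller than the lower growth
  exponent of \<open>\<Phi>\<close>.  For every integer \<open>k\<close>, Vitali's lemma selects disjoint balls \<open>B_j\<close> from the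
  balls with \<open>2^k < A \<le> 2^(k+1)\<close> such that each of the latter lies in some \<open>5 B_j\<close>.  On \<open>5 B_j\<close> the
  oscillation \<open>|b(x) - b_B|\<close>, simultaneously for all smaller balls \<open>B\<close> centred at \<open>x\<close>, has
  exponentially small distribution, so the modular of level \<open>k\<close> is at most a constant times
  \<open>\<Psi>(2^k) \<Sum>\<^sub>j |B_j|\<close>.  The relation between the inverses turns \<open>A > 2^k\<close> into a lower bound for the
  \<open>s\<close>-average of \<open>f\<close>, hence \<open>\<Sum>\<^sub>j |B_j|\<close> is controlled by the integral of \<open>|f|^s\<close> over the set
  where \<open>|f|\<close> is large, and the sum over \<open>k\<close> is geometric.
\<close>

section \<open>Young functions and their indices\<close>

text \<open>The factor \<open>|b(x) - b_B|\<close> is unbounded and changes with the radius, so it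
  cannot be split off before the supremum over the radii is taken. Sorting the balls by the size of
  \<open>A\<close> freezes \<open>A\<close> up to a factor 2; what remains is to control the
  oscillation at one point for all radii simultaneously. For this reason the John-Nirenberg
  induction is run on the ball means of \<open>b\<close>, and the values of \<open>b\<close> are
  recovered from means over tiny balls. The exponent \<open>s\<close> needs room on both sides: s >
  1 gives a finite conjugate exponent \<open>s'\<close>, and s < p leaves the power p - s that makes
  the sum over levels geometric. The lower index supplies p, the upper index the doubling constants.
  Suprema over uncountably many balls are dominated almost everywhere by measurable majorants, and
  exceptional sets are enclosed in measurable covers. The estimates are made for functions whose
  \<Phi>-modular is at most 1; homogeneity and convexity of \<Psi> then give the norm
  inequality.\<close>

locale doubling_convex =
  fixes \<phi> :: "real \<Rightarrow> real" and D :: real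
  assumes convex: "convex_on {0..} \<phi>"
    and zero [simp]: "\<phi> 0 = 0"
    and pos: "\<And>t. 0 < t \<Longrightarrow> 0 < \<phi> t"
    and doubling: "\<And>t. 0 < t \<Longrightarrow> \<phi> (2 * t) \<le> D * \<phi> t"
begin

lemma nonneg: "0 \<le> t \<Longrightarrow> 0 \<le> \<phi> t"
  using pos[of t] by (cases "t = 0") auto

lemma contract: "\<phi> (u * t) \<le> u * \<phi> t" if "0 \<le> t" "0 \<le> u" "u \<le> 1"
  using convex_onD[OF convex, of u 0 t] that by simp

lemma less: "\<phi> s < \<phi> t" if "0 \<le> s" "s < t"
proof -
  have "\<phi> s = \<phi> (s / t * t)" using that by simp
  also have "\<dots> \<le> s / t * \<phi> t" using that by (intro contract) auto
  also have "\<dots> < 1 * \<phi> t" using that pos[of t] by (intro mult_strict_right_mono) auto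
  finally show ?thesis by simp
qed

lemma mono: "\<phi> s \<le> \<phi> t" if "0 \<le> s" "s \<le> t"
  using less[of s t] that by (cases "s = t") auto

lemma less_iff: "0 \<le> s \<Longrightarrow> 0 \<le> t \<Longrightarrow> \<phi> s < \<phi> t \<longleftrightarrow> s < t"
  using less[of s t] mono[of t s] by linarith

lemma le_iff: "0 \<le> s \<Longrightarrow> 0 \<le> t \<Longrightarrow> \<phi> s \<le> \<phi> t \<longleftrightarrow> s \<le> t"
  using less_iff[of t s] by linarith

lemma two_le: "0 \<le> t \<Longrightarrow> 2 * \<phi> t \<le> \<phi> (2 * t)"
  using contract[of "2 * t" "1 / 2"] by simp

lemma D_ge_2: "2 \<le> D"
proof -
  have "2 * \<phi> 1 \<le> D * \<phi> 1" using two_le[of 1] doubling[of 1] by simp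
  then show ?thesis using pos[of 1] by simp
qed

text \<open>Since \<phi> vanishes at 0, convexity puts it below the line through (1, \<phi> 1) on
  [0, 1] and above that line beyond 1; hence \<open>a\<close> and \<open>c\<close> bracket the
  solution. The interval stays away from 0 because convexity gives continuity only in the open
  half-line.\<close>

lemma surj: assumes "0 < y" obtains t where "0 < t" "\<phi> t = y"
proof -
  define a where "a = min 1 (y / \<phi> 1)"
  define c where "c = max 1 (y / \<phi> 1)"
  have p1: "0 < \<phi> 1" by (rule pos) simp
  have a0: "0 < a" using assms p1 by (simp add: a_def)
  have avg_const: "1 \<le> c" by (simp add: c_def)
  have "\<phi> a \<le> a * \<phi> 1" using contract[of 1 a] a0 by (simp add: a_def)
  also have "\<dots> \<le> y / \<phi> 1 * \<phi> 1" using p1 by (intro mult_right_mono) (auto simp: a_def)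
  finally have lo: "\<phi> a \<le> y" using p1 by simp
  have "\<phi> 1 \<le> 1 / c * \<phi> c" using contract[of c "1 / c"] avg_const by simp
  then have "c * \<phi> 1 \<le> \<phi> c" using avg_const by (simp add: field_simps)
  moreover have "y / \<phi> 1 * \<phi> 1 \<le> c * \<phi> 1" using p1 by (intro mult_right_mono) (auto simp: c_def)
  ultimately have hi: "y \<le> \<phi> c" using p1 by simp
  have "convex_on {0<..} \<phi>" by (rule convex_on_subset[OF convex]) auto
  then have "continuous_on {0<..} \<phi>" by (intro convex_on_continuous) auto
  then have "continuous_on {a..c} \<phi>" by (rule continuous_on_subset) (use a0 in auto)
  moreover have "a \<le> c" by (simp add: a_def c_def)
  ultimately obtain t where "a \<le> t" "t \<le> c" "\<phi> t = y"
    using IVT'[of \<phi> a y c] lo hi by auto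
  then show ?thesis using a0 that[of t] by simp
qed

lemma doubling_pow: "0 < t \<Longrightarrow> \<phi> (2 ^ n * t) \<le> D ^ n * \<phi> t"
proof (induction n)
  case (Suc n)
  have "\<phi> (2 ^ Suc n * t) \<le> D * \<phi> (2 ^ n * t)"
    using doubling[of "2 ^ n * t"] Suc.prems by (simp add: mult.assoc)
  also have "\<dots> \<le> D * (D ^ n * \<phi> t)" using Suc D_ge_2 by (intro mult_left_mono) auto
  finally show ?case by simp
qed auto

lemma borel_measurable_abs [measurable]: "(\<lambda>t. \<phi> \<bar>t\<bar>) \<in> borel_measurable borel"
proof -
  \<comment> \<open>Nothing is known about \<phi> at negative arguments; cutting them off yields a
    function that is monotone everywhere.\<close>
  have "mono (\<lambda>t. \<phi> (max 0 t))" by (auto simp: mono_def intro!: mono)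
  then have "(\<lambda>t. \<phi> (max 0 t)) \<in> borel_measurable borel" by (rule borel_measurable_mono)
  then have "(\<lambda>t. \<phi> (max 0 \<bar>t\<bar>)) \<in> borel_measurable borel" by measurable
  then show ?thesis by (simp add: max_def)
qed

text \<open>For 2^n \<le> y < 2^(n+1), doubling n + 1 times costs D * D^n, and D \<le> 2^q bounds
  D^n by y^q.\<close>

lemma growth_upper:
  assumes "D \<le> 2 ^ q" "0 < t" "1 \<le> y"
  shows "\<phi> (y * t) \<le> D * y ^ q * \<phi> t"
proof -
  obtain n where n: "2 ^ n \<le> y" "y < 2 ^ Suc n"
  proof -
    have fl: "0 \<le> log 2 y" using assms by simp
    define n where "n = nat \<lfloor>log 2 y\<rfloor>"
    have "real n \<le> log 2 y" "log 2 y < real (Suc n)" using fl unfolding n_def by linarith+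
    then have "2 powr real n \<le> y" "y < 2 powr real (Suc n)"
      using assms by (simp_all add: le_log_iff log_less_iff)
    then have "2 ^ n \<le> y" "y < 2 ^ Suc n" by (simp_all only: powr_realpow[OF zero_less_numeral])
    then show ?thesis by (rule that)
  qed
  have D0: "0 \<le> D" using D_ge_2 by simp
  have "D ^ n \<le> (2 ^ q) ^ n" using assms D_ge_2 by (intro power_mono) auto
  also have "\<dots> = (2 ^ n) ^ q" by (simp flip: power_mult add: mult.commute)
  also have "\<dots> \<le> y ^ q" using n by (intro power_mono) auto
  finally have Dn: "D ^ n \<le> y ^ q" .
  have "\<phi> (y * t) \<le> \<phi> (2 ^ Suc n * t)" using assms n by (intro mono mult_right_mono) auto
  also have "\<dots> \<le> D ^ Suc n * \<phi> t" by (rule doubling_pow) fact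
  also have "\<dots> \<le> D * y ^ q * \<phi> t"
    using Dn D0 nonneg[of t] assms by (auto intro!: mult_right_mono mult_left_mono)
  finally show ?thesis .
qed

text \<open>Iteration of \<open>lower\<close> gives the power p at dyadic multiples of t; the factor
  2^p pays for rounding u / t down to a power of 2.\<close>

lemma growth_lower:
  assumes "1 < p" and lower: "\<And>t. 0 < t \<Longrightarrow> 2 powr p * \<phi> t \<le> \<phi> (2 * t)"
    and "0 < t" "t \<le> u"
  shows "(u / t) powr p * \<phi> t \<le> 2 powr p * \<phi> u"
proof -
  have it: "(2 powr p) ^ n * \<phi> t \<le> \<phi> (2 ^ n * t)" for n
  proof (induction n)
    case (Suc n)
    have "(2 powr p) ^ Suc n * \<phi> t \<le> 2 powr p * \<phi> (2 ^ n * t)" using Suc by (simp add: mult.assoc)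
    also have "\<dots> \<le> \<phi> (2 * (2 ^ n * t))" by (rule lower) (use assms in auto)
    finally show ?case by (simp add: mult.assoc)
  qed auto
  have u: "1 \<le> u / t" using assms by simp
  define n where "n = nat \<lfloor>log 2 (u / t)\<rfloor>"
  have "0 \<le> log 2 (u / t)" using u by simp
  then have "real n \<le> log 2 (u / t)" "log 2 (u / t) < real (Suc n)" unfolding n_def by linarith+
  then have "2 powr real n \<le> u / t" "u / t < 2 powr real (Suc n)"
    using u by (simp_all add: le_log_iff log_less_iff)
  then have n: "2 ^ n \<le> u / t" "u / t < 2 ^ Suc n" by (simp_all only: powr_realpow[OF zero_less_numeral])
  have "(u / t) powr p \<le> (2 ^ Suc n) powr p" using n u assms by (intro powr_mono2) auto
  also have "\<dots> = (2 powr p) ^ Suc n"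
    by (simp only: powr_realpow[OF zero_less_numeral, symmetric] powr_powr powr_gt_zero
        powr_realpow[symmetric] mult.commute)
  finally have "(u / t) powr p * \<phi> t \<le> (2 powr p) ^ Suc n * \<phi> t"
    using assms nonneg[of t] by (intro mult_right_mono) auto
  also have "\<dots> = 2 powr p * ((2 powr p) ^ n * \<phi> t)" by simp
  also have "\<dots> \<le> 2 powr p * \<phi> (2 ^ n * t)" using it by (intro mult_left_mono) auto
  also have "\<dots> \<le> 2 powr p * \<phi> u"
    using n assms by (intro mult_left_mono mono) (auto simp: field_simps)
  finally show ?thesis .
qed

end

text \<open>Slopes of chords at t increase with the other endpoint. So the right slopes converge to
  their infimum L, all left slopes lie below L, and the line of slope L through (t, f t) supports f
  from below. This makes the \<open>Lim\<close> in \<open>young_deriv\<close> accessible.\<close>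

lemma convex_slope_tendsto:
  fixes f :: "real \<Rightarrow> real"
  assumes f: "convex_on {0..} f" and t: "0 < t"
  obtains L where "((\<lambda>s. (f s - f t) / (s - t)) \<longlongrightarrow> L) (at_right t)"
    "\<And>s. 0 \<le> s \<Longrightarrow> f t + L * (s - t) \<le> f s"
proof -
  define g where "g s = (f s - f t) / (s - t)" for s
  have g': "g s = (f t - f s) / (t - s)" for s unfolding g_def
    by (metis minus_diff_eq minus_divide_divide)
  have m1: "g s \<le> g r" if "t < s" "s \<le> r" for s r
  proof (cases "s = r")
    case False
    then show ?thesis using convex_on_slope_le(1)[OF f, of t r s] that t unfolding g' by auto
  qed simp
  have m2: "g s \<le> g r" if "0 \<le> s" "s < t" "t < r" for s r
    using convex_on_slope_le[OF f, of s r t] that t unfolding g' g_def[of s]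
    by (smt (verit) atLeast_iff minus_diff_eq minus_divide_divide)
  define L where "L = Inf (g ` {t<..})"
  have bdd: "bdd_below (g ` {t<..})" using m2[of 0] t by (intro bdd_belowI[of _ "g 0"]) auto
  have L1: "L \<le> g r" if "t < r" for r unfolding L_def using that bdd by (intro cInf_lower) auto
  have L2: "g s \<le> L" if "0 \<le> s" "s < t" for s
    unfolding L_def using that m2[of s] by (intro cInf_greatest) (auto intro: gt_ex)
  have "(g \<longlongrightarrow> L) (at_right t)"
  proof (rule order_tendstoI)
    fix a assume "a < L"
    then show "eventually (\<lambda>s. a < g s) (at_right t)"
      using L1 by (auto simp: eventually_at_right_field intro!: exI[of _ "t + 1"] intro: less_le_trans)
  next
    fix a assume "L < a"
    then obtain r where "t < r" "g r < a"
      unfolding L_def using bdd by (subst (asm) cInf_less_iff) auto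
    then show "eventually (\<lambda>s. g s < a) (at_right t)"
      unfolding eventually_at_right_field by (meson m1 less_imp_le le_less_trans)
  qed
  moreover have "f t + L * (s - t) \<le> f s" if "0 \<le> s" for s
  proof (cases s t rule: linorder_cases)
    case less
    then show ?thesis using L2[of s] that by (simp add: g_def field_simps)
  next
    case greater
    then show ?thesis using L1[of s] by (simp add: g_def field_simps)
  qed auto
  ultimately show ?thesis using that[of L] unfolding g_def by blast
qed

text \<open>The supporting line \<open>sub\<close> at t converts the indices into growth in both
  directions. Evaluated at 2t, with t \<Phi>'(t) \<ge> \<kappa> \<Phi>(t), it gives \<phi>(2t) \<ge>
  (1 + \<kappa>) \<phi>(t), hence p = log_2(1 + \<kappa>) > 1. Evaluated to the left at \<rho> t,
  with t \<Phi>'(t) \<le> Q \<Phi>(t) and 1 - \<rho> = 1/(2Q), it gives \<phi>(\<rho> t) \<ge>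
  \<phi>(t)/2; iterating until \<rho>^m < 1/2 yields the doubling constant 2^m.\<close>

lemma young_regular:
  assumes Y: "young_function \<Phi>" and lo: "1 < lower_index \<Phi>" and up: "upper_index \<Phi> < \<infinity>"
  obtains D p where "1 < p" "doubling_convex (\<lambda>t. enn2real (\<Phi> t)) D"
    "\<And>t. 0 \<le> t \<Longrightarrow> \<Phi> t = ennreal (enn2real (\<Phi> t))"
    "\<And>t. 0 < t \<Longrightarrow> 2 powr p * enn2real (\<Phi> t) \<le> enn2real (\<Phi> (2 * t))"
proof -
  define \<phi> where "\<phi> t = enn2real (\<Phi> t)" for t
  have ind: "young_indices_defined \<Phi>" using lo by (auto simp: lower_index_def split: if_splits)
  have \<Phi>0: "\<Phi> 0 = 0" using Y by (simp add: young_function_def)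
  have fin: "\<Phi> t < \<infinity>" if "0 \<le> t" for t
    using ind that \<Phi>0 by (cases "t = 0") (auto simp: young_indices_defined_def)
  have \<Phi>: "\<Phi> t = ennreal (\<phi> t)" if "0 \<le> t" for t
    using fin[OF that] by (simp add: \<phi>_def less_top)
  have pos: "0 < \<phi> t" if "0 < t" for t
    using ind that by (auto simp: young_indices_defined_def \<phi>_def enn2real_positive_iff less_top)
  have nn: "0 \<le> \<phi> t" for t by (simp add: \<phi>_def)
  have cvx: "convex_on {0..} \<phi>"
  proof (rule convex_onI)
    fix u x y :: real assume u: "0 < u" "u < 1" and xy: "x \<in> {0..}" "y \<in> {0..}"
    have "\<Phi> ((1 - u) * x + u * y) \<le> ennreal (1 - u) * \<Phi> x + ennreal u * \<Phi> y"
      using Y u xy by (auto simp: young_function_def)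
    then have "ennreal (\<phi> ((1 - u) * x + u * y)) \<le> ennreal ((1 - u) * \<phi> x + u * \<phi> y)"
      using u xy by (subst (asm) (1 2 3) \<Phi>) (auto simp: ennreal_mult ennreal_plus nn)
    then show "\<phi> ((1 - u) *\<^sub>R x + u *\<^sub>R y) \<le> (1 - u) * \<phi> x + u * \<phi> y"
      using u nn by (subst (asm) ennreal_le_iff) auto
  qed simp
  define R where "R t = t * young_deriv \<Phi> t / \<phi> t" for t
  have sub: "\<phi> t + young_deriv \<Phi> t * (s - t) \<le> \<phi> s" if "0 < t" "0 \<le> s" for s t
  proof -
    obtain L where L: "((\<lambda>s. (\<phi> s - \<phi> t) / (s - t)) \<longlongrightarrow> L) (at_right t)"
      "\<And>s. 0 \<le> s \<Longrightarrow> \<phi> t + L * (s - t) \<le> \<phi> s"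
      using convex_slope_tendsto[OF cvx \<open>0 < t\<close>] by blast
    have "young_deriv \<Phi> t = L"
      using tendsto_Lim[OF _ L(1)] by (simp add: young_deriv_def \<phi>_def)
    then show ?thesis using L(2)[OF that(2)] by simp
  qed
  have "1 < (INF t\<in>{0<..}. ereal (R t))"
    using lo ind by (simp add: lower_index_def R_def \<phi>_def)
  \<comment> \<open>A number strictly between 1 and the infimum keeps the gap above 1 and is finite,
    even if the infimum is compared in the extended reals.\<close>
  then obtain e where e: "1 < e" "e < (INF t\<in>{0<..}. ereal (R t))" using dense by blast
  then have eR: "e \<le> ereal (R t)" if "0 < t" for t
    using that by (meson INF_lower greaterThan_iff less_imp_le order_trans)
  then obtain \<kappa> where \<kappa>: "1 < \<kappa>" "\<And>t. 0 < t \<Longrightarrow> \<kappa> \<le> R t"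
    using e(1) eR[of 1] by (cases e) (auto simp: one_ereal_def)
  have "(SUP t\<in>{0<..}. ereal (R t)) < \<infinity>"
    using up ind by (simp add: upper_index_def R_def \<phi>_def)
  then obtain e' where e': "(SUP t\<in>{0<..}. ereal (R t)) < e'" "e' < \<infinity>" using dense by blast
  then have eR': "ereal (R t) \<le> e'" if "0 < t" for t
    using that by (meson SUP_upper greaterThan_iff less_imp_le order_trans)
  then obtain Q where Q: "1 < Q" "\<And>t. 0 < t \<Longrightarrow> R t \<le> Q"
  proof (cases e')
    case (real q)
    have "R t \<le> q" if "0 < t" for t using eR'[OF that] real by simp
    moreover from this[of 1] have "1 < q" using \<kappa>(1) \<kappa>(2)[of 1] by simp
    ultimately show ?thesis using that by blast
  qed (use e'(2) eR'[of 1] in auto)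
  define p where "p = log 2 (1 + \<kappa>)"
  have "1 < p" unfolding p_def using \<kappa> by (simp add: less_log_iff)
  moreover have "2 powr p * \<phi> t \<le> \<phi> (2 * t)" if "0 < t" for t
  proof -
    have "\<kappa> * \<phi> t \<le> t * young_deriv \<Phi> t"
      using \<kappa>(2)[OF that] pos[OF that] by (simp add: R_def field_simps)
    then have "(1 + \<kappa>) * \<phi> t \<le> \<phi> (2 * t)"
      using sub[of t "2 * t"] that by (simp add: algebra_simps)
    then show ?thesis using \<kappa> by (simp add: p_def)
  qed
  moreover
  define \<rho> where "\<rho> = 1 - 1 / (2 * Q)"
  have \<rho>: "0 < \<rho>" "\<rho> < 1" using Q by (auto simp: \<rho>_def field_simps)
  have half: "\<phi> t \<le> 2 * \<phi> (\<rho> * t)" if "0 < t" for t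
  proof -
    have "t * young_deriv \<Phi> t \<le> Q * \<phi> t"
      using Q(2)[OF that] pos[OF that] by (simp add: R_def field_simps)
    then have "(1 - \<rho>) * (t * young_deriv \<Phi> t) \<le> (1 - \<rho>) * (Q * \<phi> t)"
      using \<rho> by (intro mult_left_mono) auto
    also have "\<dots> = \<phi> t / 2" using Q by (simp add: \<rho>_def)
    finally show ?thesis using sub[of t "\<rho> * t"] that \<rho> by (simp add: algebra_simps)
  qed
  have half_pow: "\<phi> t \<le> 2 ^ m * \<phi> (\<rho> ^ m * t)" if "0 < t" for t m
  proof (induction m)
    case (Suc m)
    have "\<phi> (\<rho> ^ m * t) \<le> 2 * \<phi> (\<rho> * (\<rho> ^ m * t))" using \<rho> that by (intro half) auto
    then have "2 ^ m * \<phi> (\<rho> ^ m * t) \<le> 2 ^ m * (2 * \<phi> (\<rho> * (\<rho> ^ m * t)))"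
      by (intro mult_left_mono) auto
    with Suc have "\<phi> t \<le> 2 ^ m * (2 * \<phi> (\<rho> * (\<rho> ^ m * t)))" by linarith
    then show ?case by (simp add: ac_simps)
  qed auto
  have mono: "\<phi> s \<le> \<phi> t" if "0 \<le> s" "s \<le> t" for s t
  proof (cases "t = 0")
    case False
    then have "\<phi> s \<le> s / t * \<phi> t"
      using convex_onD[OF cvx, of "s / t" 0 t] that \<Phi>0 by (simp add: \<phi>_def)
    also have "\<dots> \<le> 1 * \<phi> t" using that False nn by (intro mult_right_mono) auto
    finally show ?thesis by simp
  qed (use that in auto)
  obtain m where m: "\<rho> ^ m < 1 / 2" using real_arch_pow_inv[of "1/2" \<rho>] \<rho> by auto
  have "doubling_convex \<phi> (2 ^ m)"
  proof
    fix t :: real assume t: "0 < t"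
    have "\<phi> (2 * t) \<le> 2 ^ m * \<phi> (\<rho> ^ m * (2 * t))" using t by (intro half_pow) auto
    also have "\<dots> \<le> 2 ^ m * \<phi> t" using m \<rho> t by (intro mult_left_mono mono) auto
    finally show "\<phi> (2 * t) \<le> 2 ^ m * \<phi> t" .
  qed (use cvx pos \<Phi>0 in \<open>auto simp: \<phi>_def\<close>)
  ultimately show ?thesis using \<Phi> that unfolding \<phi>_def by blast
qed

text \<open>Strict monotonicity turns the superlevel set into an open half-line starting at t, so
  the generalised inverse is a true inverse.\<close>

lemma young_inv_eq:
  assumes "doubling_convex (\<lambda>t. enn2real (\<Phi> t)) D"
    "\<And>t. 0 \<le> t \<Longrightarrow> \<Phi> t = ennreal (enn2real (\<Phi> t))" and t: "0 < t"
  shows "young_inv \<Phi> (enn2real (\<Phi> t)) = t"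
proof -
  interpret doubling_convex "\<lambda>t. enn2real (\<Phi> t)" D by fact
  have "{r. 0 \<le> r \<and> \<Phi> r > ennreal (enn2real (\<Phi> t))} = {t<..}"
  proof -
    have "0 \<le> r \<and> \<Phi> r > ennreal (enn2real (\<Phi> t)) \<longleftrightarrow> t < r" for r
    proof (cases "0 \<le> r")
      case True
      then have "\<Phi> r > ennreal (enn2real (\<Phi> t)) \<longleftrightarrow> enn2real (\<Phi> t) < enn2real (\<Phi> r)"
        by (metis assms(2) enn2real_nonneg ennreal_less_iff)
      then show ?thesis using True t less_iff[of t r] by simp
    qed (use t in auto)
    then show ?thesis by auto
  qed
  then show ?thesis by (simp add: young_inv_def)
qed

section \<open>Lebesgue points\<close>

lemma measurable_ball [measurable]: "ball x r \<in> sets lebesgue"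
  by simp

lemma emeasure_ball_eq: "emeasure lebesgue (ball x r) = ennreal (measure lebesgue (ball x r))"
  using emeasure_lborel_ball_finite[of x r] by (subst emeasure_eq_ennreal_measure) auto

lemma measure_ball_pos: "0 < r \<Longrightarrow> 0 < measure lebesgue (ball (x::'a::euclidean_space) r)"
  using content_ball_pos[of r x] by simp

lemma measure_ball_scale:
  fixes x y :: "'a::euclidean_space"
  assumes "0 \<le> r" "0 \<le> c"
  shows "measure lebesgue (ball x (c * r)) = c ^ DIM('a) * measure lebesgue (ball y r)"
proof -
  have "0 \<le> c * r" using assms by simp
  have eq: "measure lebesgue (ball z s) = measure lborel (ball z s)" for z :: 'a and s by simp
  show ?thesis
    unfolding eq content_ball_conv_unit_ball[OF \<open>0 \<le> c * r\<close>, of x]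
      content_ball_conv_unit_ball[OF assms(1), of y] power_mult_distrib by (rule mult.assoc)
qed

text \<open>Sums over a Vitali family are written as integrals over \<open>count_space C\<close>,
  which treats finite and infinite families alike and lets constants be pulled out.\<close>

lemma nn_integral_UN_disjoint:
  assumes "countable C" "\<And>c. c \<in> C \<Longrightarrow> A c \<in> sets M"
    "pairwise (\<lambda>i j. disjnt (A i) (A j)) C" "h \<in> borel_measurable M"
  shows "(\<integral>\<^sup>+x\<in>(\<Union>c\<in>C. A c). h x \<partial>M) = (\<integral>\<^sup>+c. (\<integral>\<^sup>+x\<in>A c. h x \<partial>M) \<partial>count_space C)"
proof -
  have "(\<integral>\<^sup>+x\<in>(\<Union>c\<in>C. A c). h x \<partial>M) = emeasure (density M h) (\<Union>c\<in>C. A c)"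
    using assms by (intro emeasure_density[symmetric]) auto
  also have "\<dots> = (\<integral>\<^sup>+c. emeasure (density M h) (A c) \<partial>count_space C)"
    using assms by (intro emeasure_UN_countable) (auto simp: disjoint_family_on_def pairwise_def disjnt_def)
  also have "\<dots> = (\<integral>\<^sup>+c. (\<integral>\<^sup>+x\<in>A c. h x \<partial>M) \<partial>count_space C)"
    using assms by (intro nn_integral_cong) (auto intro!: emeasure_density)
  finally show ?thesis .
qed

text \<open>Outer regularity gives open sets with excess measure below 1/(n+1); their finite
  intersections decrease, and the excess shrinks to a null set. The measure with density
  \<open>h\<close> is finite on \<open>B\<close>, so continuity from above applies to it.\<close>

lemma outer_open_small_integral:
  fixes D :: "'a::euclidean_space set"
  assumes D: "D \<in> sets lebesgue" and h[measurable]: "h \<in> borel_measurable lebesgue"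
    and fin: "(\<integral>\<^sup>+x\<in>B. h x \<partial>lebesgue) < \<infinity>" and B: "open B" "D \<subseteq> B" and \<eta>: "0 < \<eta>"
  obtains U where "open U" "D \<subseteq> U" "U \<subseteq> B" "(\<integral>\<^sup>+x\<in>U - D. h x \<partial>lebesgue) < \<eta>"
proof -
  have "\<exists>T. open T \<and> D \<subseteq> T \<and> emeasure lebesgue (T - D) < ennreal (1 / Suc n)" for n
    using sets_lebesgue_outer_open[OF D, of "1 / Suc n"] by (metis of_nat_0_less_iff zero_less_Suc zero_less_divide_1_iff)
  then obtain T where T: "\<And>n. open (T n)" "\<And>n. D \<subseteq> T n"
    "\<And>n. emeasure lebesgue (T n - D) < ennreal (1 / Suc n)" by metis
  define U where "U n = B \<inter> (\<Inter>i\<le>n. T i)" for n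
  have U: "open (U n)" "D \<subseteq> U n" "U n \<subseteq> B" for n
    using T B by (auto simp: U_def intro!: open_Int open_INT)
  have Um: "U n - D \<in> sets lebesgue" for n using U(1)[of n] D by auto
  define \<nu> where "\<nu> = density lebesgue h"
  have \<nu>: "emeasure \<nu> (U n - D) = (\<integral>\<^sup>+x\<in>U n - D. h x \<partial>lebesgue)" for n
    unfolding \<nu>_def by (rule emeasure_density) (use Um in auto)
  have "(\<lambda>n. emeasure \<nu> (U n - D)) \<longlonglongrightarrow> emeasure \<nu> (\<Inter>n. U n - D)"
  proof (rule Lim_emeasure_decseq)
    show "range (\<lambda>n. U n - D) \<subseteq> sets \<nu>" using Um by (auto simp: \<nu>_def)
    show "decseq (\<lambda>n. U n - D)" by (auto simp: decseq_def U_def)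
    fix n
    have "emeasure \<nu> (U n - D) \<le> (\<integral>\<^sup>+x\<in>B. h x \<partial>lebesgue)"
      unfolding \<nu> using U(3)[of n] by (intro nn_integral_mono) (auto split: split_indicator)
    then show "emeasure \<nu> (U n - D) \<noteq> \<infinity>" using fin by (auto simp: top_unique)
  qed
  moreover have "emeasure \<nu> (\<Inter>n. U n - D) = 0"
  proof -
    have "emeasure lebesgue (\<Inter>n. U n - D) \<le> 0"
    proof (rule ennreal_le_epsilon)
      fix e :: real assume "0 < e"
      then obtain n where "1 / Suc n < e" using nat_approx_posE by (metis)
      have "emeasure lebesgue (\<Inter>n. U n - D) \<le> emeasure lebesgue (T n - D)"
        using T(1)[of n] D by (intro emeasure_mono) (auto simp: U_def)
      also have "\<dots> \<le> ennreal (1 / Suc n)" using T(3)[of n] by simp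
      also have "\<dots> \<le> ennreal e" using \<open>1 / Suc n < e\<close> by (intro ennreal_leI) auto
      finally show "emeasure lebesgue (\<Inter>n. U n - D) \<le> 0 + ennreal e" by simp
    qed
    then have "(\<Inter>n. U n - D) \<in> null_sets lebesgue" using sets.countable_INT[of "\<lambda>n. U n - D" UNIV lebesgue] Um by (intro null_setsI) auto
    then have "(\<Inter>n. U n - D) \<in> null_sets \<nu>"
      unfolding \<nu>_def by (subst null_sets_density_iff) (auto intro: AE_mp[OF AE_not_in])
    then show ?thesis by auto
  qed
  ultimately have "(\<lambda>n. emeasure \<nu> (U n - D)) \<longlonglongrightarrow> 0" by simp
  then have "eventually (\<lambda>n. emeasure \<nu> (U n - D) < \<eta>) sequentially"
    using \<eta> by (rule order_tendstoD)
  then obtain n where "emeasure \<nu> (U n - D) < \<eta>" by (meson eventually_sequentially order_refl)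
  then show ?thesis using that[of "U n"] U \<nu> by auto
qed

text \<open>As \<open>ennreal\<close> cuts off negative values, the two sides are the integrals of
  the positive and negative parts of f - p. In this form the condition on the mean can be added up
  over disjoint balls.\<close>

lemma set_nn_integral_le_of_mean_le:
  assumes int: "set_integrable M B f" and B: "B \<in> sets M" "emeasure M B < \<infinity>"
    and le: "(LINT x:B|M. f x) \<le> p * measure M B"
  shows "(\<integral>\<^sup>+x\<in>B. ennreal (f x - p) \<partial>M) \<le> (\<integral>\<^sup>+x\<in>B. ennreal (p - f x) \<partial>M)"
proof -
  have Bi: "set_integrable M B (\<lambda>x. p)" using B by (simp add: set_integrable_def)
  have int': "set_integrable M B (\<lambda>x. f x - p)" using int Bi by (rule set_integral_diff)
  have "(LINT x:B|M. f x - p) = (LINT x:B|M. f x) - p * measure M B"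
    using set_integral_diff(2)[OF int Bi] B by (simp add: set_integral_const)
  then have le0: "(LINT x:B|M. f x - p) \<le> 0" using le by simp
  let ?g = "\<lambda>x. indicat_real B x * (f x - p)"
  have ig: "integrable M ?g" using int' by (simp add: set_integrable_def)
  have 1: "(\<integral>\<^sup>+x\<in>B. ennreal (f x - p) \<partial>M) = (\<integral>\<^sup>+x. ennreal (?g x) \<partial>M)"
    by (intro nn_integral_cong) (auto split: split_indicator)
  have 2: "(\<integral>\<^sup>+x\<in>B. ennreal (p - f x) \<partial>M) = (\<integral>\<^sup>+x. ennreal (- ?g x) \<partial>M)"
    by (intro nn_integral_cong) (auto split: split_indicator)
  have f1: "(\<integral>\<^sup>+x. ennreal (?g x) \<partial>M) < \<infinity>" "(\<integral>\<^sup>+x. ennreal (- ?g x) \<partial>M) < \<infinity>"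
    using ig by (auto simp: real_integrable_def less_top)
  have "enn2real (\<integral>\<^sup>+x. ennreal (?g x) \<partial>M) \<le> enn2real (\<integral>\<^sup>+x. ennreal (- ?g x) \<partial>M)"
    using le0 real_lebesgue_integral_def[OF ig] by (simp add: set_lebesgue_integral_def)
  then have "ennreal (enn2real (\<integral>\<^sup>+x. ennreal (?g x) \<partial>M)) \<le> ennreal (enn2real (\<integral>\<^sup>+x. ennreal (- ?g x) \<partial>M))"
    by (rule ennreal_leI)
  then show ?thesis unfolding 1 2 using f1 by (simp only: ennreal_enn2real infinity_ennreal_def)
qed

text \<open>Only this one-sided and subsequential form of Lebesgue's differentiation theorem is needed; it
  avoids measurability questions about the limit of the means.\<close>
lemma AE_exists_small_ball_mean_gt:
  fixes f :: "'a::euclidean_space \<Rightarrow> real"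
  assumes meas[measurable]: "f \<in> borel_measurable lebesgue"
    and loc: "\<And>x r. set_integrable lebesgue (ball x r) f"
  shows "AE x in lebesgue. \<forall>q<f x. \<forall>d>0. \<exists>r. 0 < r \<and> r < d \<and> q < ball_mean f (ball x r)"
proof -
  \<comment> \<open>Failure of the claim at x puts x into one of these sets with rational p < q,
    some d = 1/(m+1) and some natural number N, so it suffices that each of the countably many sets
    is negligible.\<close>
  define F where "F p q d N = {x \<in> ball 0 N. q < f x \<and> (\<forall>r. 0 < r \<and> r < d \<longrightarrow> ball_mean f (ball x r) \<le> p)}"
    for p q d N :: real
  have negl: "negligible (F p q d N)" if pq: "p < q" and d: "0 < d" for p q d N
  proof -
    define Dq where "Dq = {x \<in> ball 0 N. q < f x}"
    define h where "h x = ennreal (p - f x)" for x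
    have Dm: "Dq \<in> sets lebesgue" unfolding Dq_def by measurable
    have hm[measurable]: "h \<in> borel_measurable lebesgue" unfolding h_def by measurable
    have hfin: "(\<integral>\<^sup>+x\<in>ball 0 N. h x \<partial>lebesgue) < \<infinity>"
    proof -
      have "set_integrable lebesgue (ball 0 N) (\<lambda>x. p - f x)"
        by (intro set_integral_diff loc) (simp add: set_integrable_def emeasure_ball_eq)
      then have "(\<integral>\<^sup>+x. ennreal (indicat_real (ball 0 N) x * (p - f x)) \<partial>lebesgue) < \<infinity>"
        by (auto simp: real_integrable_def less_top set_integrable_def)
      also have "(\<integral>\<^sup>+x. ennreal (indicat_real (ball 0 N) x * (p - f x)) \<partial>lebesgue) = (\<integral>\<^sup>+x\<in>ball 0 N. h x \<partial>lebesgue)"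
        by (intro nn_integral_cong) (auto split: split_indicator simp: h_def)
      finally show ?thesis .
    qed
    \<comment> \<open>Disjoint balls with mean at most p cover F up to a null set inside an open U.
      Their excess over p is at least q - p on \<open>Dq\<close> and is at most their deficit below
      p. The deficit vanishes on \<open>Dq\<close>, hence lives on U - Dq, where its integral was
      made small. Only outer covers of F are measured.\<close>
    show ?thesis unfolding negligible_outer_le
    proof (intro allI impI)
      fix e :: real assume e: "0 < e"
      have "0 < ennreal ((q - p) * e)" using e pq by simp
      then obtain U where U: "open U" "Dq \<subseteq> U" "U \<subseteq> ball 0 N"
        "(\<integral>\<^sup>+x\<in>U - Dq. h x \<partial>lebesgue) < ennreal ((q - p) * e)"
        by (rule outer_open_small_integral[OF Dm hm hfin, rotated 2]) (auto simp: Dq_def)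
      define K where "K = {(x, r). x \<in> F p q d N \<and> 0 < r \<and> r < d \<and> ball x r \<subseteq> U}"
      have FD: "F p q d N \<subseteq> Dq" by (auto simp: F_def Dq_def)
      have "\<exists>i. i \<in> K \<and> x \<in> ball (fst i) (snd i) \<and> snd i < e'" if x: "x \<in> F p q d N" "0 < e'" for x e'
      proof -
        obtain r where r: "0 < r" "ball x r \<subseteq> U" using U x FD by (meson openE subsetD)
        define s where "s = min r (min d e') / 2"
        have "ball x s \<subseteq> ball x r" using r x d by (intro subset_ball) (auto simp: s_def)
        then have "(x, s) \<in> K" "s < e'" "0 < s" using r x d by (auto simp: K_def s_def)
        then show ?thesis by (intro exI[of _ "(x, s)"]) auto
      qed
      then obtain C where C: "countable C" "C \<subseteq> K"
         "pairwise (\<lambda>i j. disjnt (ball (fst i) (snd i)) (ball (fst j) (snd j))) C"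
         "negligible (F p q d N - (\<Union>i \<in> C. ball (fst i) (snd i)))"
        using Vitali_covering_theorem_balls[of "F p q d N" K fst snd] by blast
      define V where "V = (\<Union>i \<in> C. ball (fst i) (snd i))"
      have VU: "V \<subseteq> U" using C(2) unfolding V_def K_def by fastforce
      have Vm[measurable]: "V \<in> sets lebesgue" unfolding V_def using C(1) by (intro sets.countable_UN') auto
      have "ennreal (q - p) * emeasure lebesgue (V \<inter> Dq) = (\<integral>\<^sup>+x. ennreal (q - p) * indicator (V \<inter> Dq) x \<partial>lebesgue)"
        using Dm by (subst nn_integral_cmult_indicator) auto
      also have "\<dots> \<le> (\<integral>\<^sup>+x\<in>V. ennreal (f x - p) \<partial>lebesgue)"
        by (intro nn_integral_mono) (auto split: split_indicator simp: Dq_def intro!: ennreal_leI)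
      also have "\<dots> = (\<integral>\<^sup>+i. (\<integral>\<^sup>+x\<in>ball (fst i) (snd i). ennreal (f x - p) \<partial>lebesgue) \<partial>count_space C)"
        unfolding V_def by (rule nn_integral_UN_disjoint) (use C in auto)
      also have "\<dots> \<le> (\<integral>\<^sup>+i. (\<integral>\<^sup>+x\<in>ball (fst i) (snd i). h x \<partial>lebesgue) \<partial>count_space C)"
      proof (rule nn_integral_mono, unfold h_def, rule set_nn_integral_le_of_mean_le)
        fix i assume "i \<in> space (count_space C)"
        then have i: "fst i \<in> F p q d N" "0 < snd i" "snd i < d" using C(2) by (auto simp: K_def)
        then have "ball_mean f (ball (fst i) (snd i)) \<le> p" by (auto simp: F_def)
        then show "(LINT x:ball (fst i) (snd i)|lebesgue. f x) \<le> p * measure lebesgue (ball (fst i) (snd i))"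
          using measure_ball_pos[OF i(2), of "fst i"] by (simp add: ball_mean_def field_simps)
      qed (auto simp: loc emeasure_ball_eq)
      also have "\<dots> = (\<integral>\<^sup>+x\<in>V. h x \<partial>lebesgue)"
        unfolding V_def by (rule nn_integral_UN_disjoint[symmetric]) (use C in auto)
      also have "\<dots> \<le> (\<integral>\<^sup>+x\<in>U - Dq. h x \<partial>lebesgue)"
        using VU pq U(3) by (intro nn_integral_mono) (auto split: split_indicator simp: h_def Dq_def ennreal_neg)
      also have "\<dots> \<le> ennreal (q - p) * ennreal e"
        using U(4) e pq by (subst ennreal_mult[symmetric]) auto
      finally have le: "emeasure lebesgue (V \<inter> Dq) \<le> ennreal e"
        using pq by (subst (asm) ennreal_mult_le_mult_iff) auto
      define T where "T = (V \<inter> Dq) \<union> (F p q d N - V)"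
      have N0: "F p q d N - V \<in> null_sets lebesgue" using C(4) by (simp add: V_def negligible_iff_null_sets)
      have eT: "emeasure lebesgue T = emeasure lebesgue (V \<inter> Dq)"
        unfolding T_def using Dm N0 by (intro emeasure_Un_null_set) auto
      have "T \<in> sets lebesgue" using Dm N0 by (auto simp: T_def)
      then have "T \<in> lmeasurable" using eT le by (auto intro!: fmeasurableI simp: le_less_trans)
      moreover have "measure lebesgue T \<le> e"
        unfolding measure_def eT using le e by (metis enn2real_leI less_imp_le)
      moreover have "F p q d N \<subseteq> T" using FD by (auto simp: T_def)
      ultimately show "\<exists>T. F p q d N \<subseteq> T \<and> T \<in> lmeasurable \<and> measure lebesgue T \<le> e" by blast
    qed
  qed
  have "AE x in lebesgue. x \<notin> F p q (1 / Suc m) (real N)" if "p < q" for p q m N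
    using negl[OF that, of "1 / Suc m" N] by (auto simp: negligible_iff_null_sets intro: AE_not_in)
  then have "AE x in lebesgue. \<forall>p\<in>\<rat>. \<forall>q\<in>\<rat>. p < q \<longrightarrow> (\<forall>m N. x \<notin> F p q (1 / Suc m) (real N))"
    by (simp add: AE_ball_countable countable_rat AE_all_countable)
  then show ?thesis
  proof eventually_elim
    case (elim x)
    show ?case
    proof (intro allI impI, rule ccontr)
      fix a d :: real assume a: "a < f x" "0 < d" "\<not> (\<exists>r. 0 < r \<and> r < d \<and> a < ball_mean f (ball x r))"
      obtain p where p: "p \<in> \<rat>" "a < p" "p < f x" using Rats_dense_in_real[OF a(1)] by blast
      obtain q where q: "q \<in> \<rat>" "p < q" "q < f x" using Rats_dense_in_real[OF p(3)] by blast
      obtain m where m: "1 / real (Suc m) < d" using nat_approx_posE[OF a(2)] by blast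
      obtain N where N: "norm x < real N" using reals_Archimedean2 by blast
      have "x \<in> F p q (1 / Suc m) (real N)"
        using a p q m N by (auto simp: F_def) (metis linorder_not_less order_trans less_imp_le less_trans)
      then show False using elim p(1) q(1,2) by blast
    qed
  qed
qed

text \<open>The one-sided statement is used for f or for -f, according to the sign of f x - c. In
  this form a large deviation of \<open>b\<close> at a point is witnessed by a deviation of a ball
  mean, so the covers constructed for means also serve for \<open>b\<close>.\<close>

lemma AE_exists_small_ball_mean_far:
  fixes f :: "'a::euclidean_space \<Rightarrow> real"
  assumes meas[measurable]: "f \<in> borel_measurable lebesgue"
    and loc: "\<And>x r. set_integrable lebesgue (ball x r) f"
  shows "AE x in lebesgue. \<forall>c y. y < \<bar>f x - c\<bar> \<longrightarrow> (\<forall>d>0. \<exists>r. 0 < r \<and> r < d \<and> y < \<bar>ball_mean f (ball x r) - c\<bar>)"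
proof -
  have mm: "ball_mean (\<lambda>x. - f x) B = - ball_mean f B" for B
    by (simp add: ball_mean_def set_lebesgue_integral_def)
  have "AE x in lebesgue. \<forall>q < - f x. \<forall>d>0. \<exists>r. 0 < r \<and> r < d \<and> q < ball_mean (\<lambda>x. - f x) (ball x r)"
    by (rule AE_exists_small_ball_mean_gt) (use loc in \<open>auto simp: set_integrable_def\<close>)
  with AE_exists_small_ball_mean_gt[OF meas loc] show ?thesis
  proof eventually_elim
    case (elim x)
    show ?case
    proof (intro allI impI)
      fix c y d :: real assume y: "y < \<bar>f x - c\<bar>" and d: "0 < d"
      show "\<exists>r. 0 < r \<and> r < d \<and> y < \<bar>ball_mean f (ball x r) - c\<bar>"
      proof (cases "c \<le> f x")
        case True
        then obtain r where "0 < r" "r < d" "y + c < ball_mean f (ball x r)"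
          using elim(1)[rule_format, of "y + c" d] y d by auto
        then show ?thesis by (intro exI[of _ r]) auto
      next
        case False
        then obtain r where "0 < r" "r < d" "y - c < - ball_mean f (ball x r)"
          using elim(2)[rule_format, of "y - c" d] y d by (auto simp: mm)
        then show ?thesis by (intro exI[of _ r]) auto
      qed
    qed
  qed
qed

section \<open>The John-Nirenberg inequality\<close>

lemma emeasure_UN_le_count_space:
  assumes "countable C" "\<And>c. c \<in> C \<Longrightarrow> U c \<in> sets M"
  shows "emeasure M (\<Union>c\<in>C. U c) \<le> (\<integral>\<^sup>+c. emeasure M (U c) \<partial>count_space C)"
proof -
  have "emeasure M (\<Union>c\<in>C. U c) = (\<integral>\<^sup>+x. indicator (\<Union>c\<in>C. U c) x \<partial>M)"
    using assms by (intro nn_integral_indicator[symmetric]) auto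
  also have "\<dots> \<le> (\<integral>\<^sup>+x. \<integral>\<^sup>+c. indicator (U c) x \<partial>count_space C \<partial>M)"
  proof (intro nn_integral_mono)
    fix x
    show "indicator (\<Union>c\<in>C. U c) x \<le> (\<integral>\<^sup>+c. indicator (U c) x \<partial>count_space C)"
    proof (cases "x \<in> (\<Union>c\<in>C. U c)")
      case True
      then obtain c where c: "c \<in> C" "x \<in> U c" by auto
      have "(1::ennreal) = indicator (U c) x" using c by simp
      also have "\<dots> \<le> (\<integral>\<^sup>+c. indicator (U c) x \<partial>count_space C)"
        by (rule nn_integral_ge_point) fact
      finally show ?thesis using True by simp
    qed auto
  qed
  also have "\<dots> = (\<integral>\<^sup>+c. \<integral>\<^sup>+x. indicator (U c) x \<partial>M \<partial>count_space C)"
    using assms by (intro nn_integral_count_space_nn_integral) auto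
  also have "\<dots> = (\<integral>\<^sup>+c. emeasure M (U c) \<partial>count_space C)"
    using assms by (intro nn_integral_cong) auto
  finally show ?thesis .
qed

text \<open>The bound is stated with K > 0, so that the constants built from it are positive and can
  be divided by.\<close>

locale bmo_fun =
  fixes b :: "'a::euclidean_space \<Rightarrow> real" and K :: real
  assumes meas [measurable]: "b \<in> borel_measurable lebesgue"
    and loc: "\<And>x r. set_integrable lebesgue (ball x r) b"
    and K_pos: "0 < K"
    and osc: "\<And>x r. 0 < r \<Longrightarrow>
      (LINT y:ball x r|lebesgue. \<bar>b y - ball_mean b (ball x r)\<bar>) \<le> K * measure lebesgue (ball x r)"
begin

abbreviation vol :: "'a \<Rightarrow> real \<Rightarrow> real" where "vol x r \<equiv> measure lebesgue (ball x r)"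

definition mean :: "'a \<Rightarrow> real \<Rightarrow> real" where "mean x r = ball_mean b (ball x r)"

lemma set_integrable_deviation: "set_integrable lebesgue (ball x r) (\<lambda>y. \<bar>b y - c\<bar>)"
proof -
  have "set_integrable lebesgue (ball x r) (\<lambda>y. b y - c)"
    by (intro set_integral_diff loc) (simp add: set_integrable_def emeasure_ball_eq)
  then show ?thesis by (rule set_integrable_abs)
qed

lemma nn_integral_deviation_eq: "(\<integral>\<^sup>+y\<in>ball x r. ennreal \<bar>b y - c\<bar> \<partial>lebesgue) = ennreal (LINT y:ball x r|lebesgue. \<bar>b y - c\<bar>)"
proof -
  have "(\<integral>\<^sup>+y\<in>ball x r. ennreal \<bar>b y - c\<bar> \<partial>lebesgue) = (\<integral>\<^sup>+y. ennreal (indicat_real (ball x r) y * \<bar>b y - c\<bar>) \<partial>lebesgue)"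
    by (intro nn_integral_cong) (auto split: split_indicator)
  also have "\<dots> = ennreal (LINT y:ball x r|lebesgue. \<bar>b y - c\<bar>)"
    unfolding set_lebesgue_integral_def using set_integrable_deviation[of x r c]
    by (subst nn_integral_eq_integral) (auto simp: set_integrable_def)
  finally show ?thesis .
qed

lemma osc_nn: "0 < r \<Longrightarrow> (\<integral>\<^sup>+y\<in>ball x r. ennreal \<bar>b y - mean x r\<bar> \<partial>lebesgue) \<le> ennreal (K * vol x r)"
  unfolding nn_integral_deviation_eq mean_def using osc by (rule ennreal_leI)

lemma mean_dist: 
  assumes r: "0 < r"
  shows "ennreal (\<bar>mean x r - c\<bar> * vol x r) \<le> (\<integral>\<^sup>+y\<in>ball x r. ennreal \<bar>b y - c\<bar> \<partial>lebesgue)"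
proof -
  have ci: "set_integrable lebesgue (ball x r) (\<lambda>y. c)" by (simp add: set_integrable_def emeasure_ball_eq)
  have "(mean x r - c) * vol x r = (LINT y:ball x r|lebesgue. b y) - (LINT y:ball x r|lebesgue. c)"
    using measure_ball_pos[OF r, of x]
    by (subst set_integral_const) (auto simp: mean_def ball_mean_def emeasure_ball_eq field_simps)
  also have "\<dots> = (LINT y:ball x r|lebesgue. b y - c)"
    by (rule set_integral_diff(2)[symmetric]) (fact loc ci)+
  finally have "\<bar>mean x r - c\<bar> * vol x r = \<bar>LINT y:ball x r|lebesgue. b y - c\<bar>"
    by (metis abs_mult abs_of_nonneg measure_nonneg)
  also have "\<dots> \<le> (LINT y:ball x r|lebesgue. \<bar>b y - c\<bar>)"
    using set_integral_norm_bound[of lebesgue "ball x r" "\<lambda>y. b y - c"] set_integral_diff(1)[OF loc ci] by simp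
  finally show ?thesis unfolding nn_integral_deviation_eq by (rule ennreal_leI)
qed

text \<open>The mean of |b - mean x r| over the smaller ball exceeds that over the larger one at
  most by the ratio of the volumes, which is at most c^n with n the dimension.\<close>

lemma mean_diff:
  assumes sub: "ball y s \<subseteq> ball x r" and s: "0 < s" and r: "0 < r" "r \<le> c * s"
  shows "\<bar>mean y s - mean x r\<bar> \<le> c ^ DIM('a) * K"
proof -
  have c: "0 \<le> c" using s r by (smt (verit) mult_neg_pos)
  have "ennreal (\<bar>mean y s - mean x r\<bar> * vol y s) \<le> (\<integral>\<^sup>+y\<in>ball y s. ennreal \<bar>b y - mean x r\<bar> \<partial>lebesgue)"
    by (rule mean_dist) fact
  also have "\<dots> \<le> (\<integral>\<^sup>+y\<in>ball x r. ennreal \<bar>b y - mean x r\<bar> \<partial>lebesgue)"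
    using sub by (intro nn_integral_mono) (auto split: split_indicator)
  also have "\<dots> \<le> ennreal (K * vol x r)" by (rule osc_nn) fact
  finally have "\<bar>mean y s - mean x r\<bar> * vol y s \<le> K * vol x r"
    using K_pos by (subst (asm) ennreal_le_iff) auto
  also have "vol x r \<le> vol x (c * s)"
    using r by (intro measure_mono_fmeasurable subset_ball) auto
  also have "vol x (c * s) = c ^ DIM('a) * vol y s" using c s by (intro measure_ball_scale) auto
  finally have "\<bar>mean y s - mean x r\<bar> * vol y s \<le> (c ^ DIM('a) * K) * vol y s"
    using K_pos by (simp add: mult_ac)
  then show ?thesis using measure_ball_pos[OF s, of y] by simp
qed

text \<open>Chosen so that one stage of \<open>john_nirenberg_cover\<close> halves the measure: 10^n
  for the tenfold balls, (1 + 2^n) 2^n K for the oscillation in the double ball, and a final 2; the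
  powers combine to 20^n.\<close>

definition threshold :: real where "threshold = 2 * 20 ^ DIM('a) * (1 + 2 ^ DIM('a)) * K"
text \<open>Bounds the drift of the mean from a ball to a selected tenfold ball. The second summand
  compares both with a common ball of elevenfold radius, at a cost of 11^n K each.\<close>

definition step :: real where "step = threshold + 2 * 11 ^ DIM('a) * K"

lemma threshold_pos: "0 < threshold" and step_pos: "0 < step" and threshold_less_step: "threshold < step"
  using K_pos by (auto simp: threshold_def step_def add_pos_pos)

text \<open>Balls centred in \<open>ball x r\<close> with radius at most r leave that ball but stay
  in its double, while the reference value is still the mean over the original ball.\<close>

lemma osc_double:
  assumes "0 < r"
  shows "(\<integral>\<^sup>+y\<in>ball x (2 * r). ennreal \<bar>b y - mean x r\<bar> \<partial>lebesgue)
    \<le> ennreal ((1 + 2 ^ DIM('a)) * K * 2 ^ DIM('a) * vol x r)"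
proof -
  let ?B = "ball x (2 * r)"
  have d: "\<bar>mean x r - mean x (2 * r)\<bar> \<le> 2 ^ DIM('a) * K"
    using assms by (intro mean_diff subset_ball) auto
  have "(\<integral>\<^sup>+y\<in>?B. ennreal \<bar>b y - mean x r\<bar> \<partial>lebesgue)
      \<le> (\<integral>\<^sup>+y. ennreal \<bar>b y - mean x (2 * r)\<bar> * indicator ?B y + ennreal (2 ^ DIM('a) * K) * indicator ?B y \<partial>lebesgue)"
  proof (intro nn_integral_mono)
    fix y
    have "ennreal \<bar>b y - mean x r\<bar> \<le> ennreal (\<bar>b y - mean x (2 * r)\<bar> + 2 ^ DIM('a) * K)"
      using d by (intro ennreal_leI) linarith
    also have "\<dots> = ennreal \<bar>b y - mean x (2 * r)\<bar> + ennreal (2 ^ DIM('a) * K)"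
      using K_pos by (intro ennreal_plus) auto
    finally show "ennreal \<bar>b y - mean x r\<bar> * indicator ?B y \<le> ennreal \<bar>b y - mean x (2 * r)\<bar> * indicator ?B y + ennreal (2 ^ DIM('a) * K) * indicator ?B y"
      by (auto split: split_indicator)
  qed
  also have "\<dots> = (\<integral>\<^sup>+y\<in>?B. ennreal \<bar>b y - mean x (2 * r)\<bar> \<partial>lebesgue) + ennreal (2 ^ DIM('a) * K) * emeasure lebesgue ?B"
    by (subst nn_integral_add) (auto simp: nn_integral_cmult_indicator)
  also have "\<dots> \<le> ennreal (K * vol x (2 * r)) + ennreal (2 ^ DIM('a) * K) * ennreal (vol x (2 * r))"
    unfolding emeasure_ball_eq using assms by (intro add_right_mono osc_nn) auto
  also have "\<dots> = ennreal (K * vol x (2 * r) + 2 ^ DIM('a) * K * vol x (2 * r))"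
    using K_pos by (simp only: ennreal_mult[symmetric] ennreal_plus[symmetric] measure_nonneg mult_nonneg_nonneg
        less_imp_le zero_le_power zero_le_numeral)
  also have "K * vol x (2 * r) + 2 ^ DIM('a) * K * vol x (2 * r) = (1 + 2 ^ DIM('a)) * K * 2 ^ DIM('a) * vol x r"
    using assms measure_ball_scale[of r 2 x x] by (simp only:) (simp add: algebra_simps)
  finally show ?thesis .
qed

lemma john_nirenberg_cover:
  assumes "0 < \<rho>"
  shows "\<exists>U. U \<in> sets lebesgue \<and>
    {x \<in> ball z \<rho>. \<exists>r. 0 < r \<and> r \<le> \<rho> \<and> real i * step < \<bar>mean x r - mean z \<rho>\<bar>} \<subseteq> U \<and>
    emeasure lebesgue U \<le> ennreal ((1 / 2) ^ i * vol z \<rho>)"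
  using assms
proof (induction i arbitrary: z \<rho>)
  case 0
  have "emeasure lebesgue (ball z \<rho>) \<le> ennreal ((1 / 2) ^ 0 * vol z \<rho>)"
    unfolding emeasure_ball_eq power_0 mult_1_left by (rule order_refl)
  then show ?case by (intro exI[of _ "ball z \<rho>"] conjI measurable_ball) blast+
next
  case (Suc i)
  note \<rho> = \<open>0 < \<rho>\<close>
  define c where "c = mean z \<rho>"
  \<comment> \<open>Bad radii are taken at least half as large as the largest bad radius, so that the mean over the
     tenfold ball is still close to \<open>c\<close> and the induction hypothesis applies there.\<close>
  define \<K> where "\<K> = {(x, r). x \<in> ball z \<rho> \<and> 0 < r \<and> r \<le> \<rho> \<and> threshold < \<bar>mean x r - c\<bar> \<and>
     (\<forall>r'. 2 * r \<le> r' \<and> r' \<le> \<rho> \<longrightarrow> \<bar>mean x r' - c\<bar> \<le> threshold)}"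
  have \<K>r: "0 < snd i \<and> snd i \<le> \<rho>" if "i \<in> \<K>" for i using that by (auto simp: \<K>_def)
  obtain C where C: "countable C" "C \<subseteq> \<K>"
     "pairwise (\<lambda>i j. disjnt (cball (fst i) (snd i)) (cball (fst j) (snd j))) C"
     "\<And>i. i \<in> \<K> \<Longrightarrow> \<exists>j. j \<in> C \<and>
        \<not> disjnt (cball (fst i) (snd i)) (cball (fst j) (snd j)) \<and> cball (fst i) (snd i) \<subseteq> ball (fst j) (5 * snd j)"
    by (rule Vitali_covering_lemma_cballs_balls[of \<K> snd \<rho> fst, OF \<K>r]) (assumption, rule that)
  have Cp: "0 < snd j" "snd j \<le> \<rho>" "fst j \<in> ball z \<rho>" "threshold < \<bar>mean (fst j) (snd j) - c\<bar>"
    "\<And>r'. 2 * snd j \<le> r' \<Longrightarrow> r' \<le> \<rho> \<Longrightarrow> \<bar>mean (fst j) r' - c\<bar> \<le> threshold" if "j \<in> C" for j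
    using C(2) that by (auto simp: \<K>_def)
  have disj: "pairwise (\<lambda>i j. disjnt (ball (fst i) (snd i)) (ball (fst j) (snd j))) C"
    using C(3) by (rule pairwise_mono) (meson ball_subset_cball disjnt_subset1 disjnt_subset2, simp)
  define T where "T j = {x \<in> ball (fst j) (10 * snd j). \<exists>r. 0 < r \<and> r \<le> 10 * snd j \<and>
    real i * step < \<bar>mean x r - mean (fst j) (10 * snd j)\<bar>}" for j
  have "\<forall>j\<in>C. \<exists>U. U \<in> sets lebesgue \<and> T j \<subseteq> U \<and>
    emeasure lebesgue U \<le> ennreal ((1 / 2) ^ i * vol (fst j) (10 * snd j))"
    unfolding T_def by (intro ballI Suc.IH) (simp add: Cp(1))
  from bchoice[OF this] obtain U where U: "\<And>j. j \<in> C \<Longrightarrow> U j \<in> sets lebesgue"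
    "\<And>j. j \<in> C \<Longrightarrow> T j \<subseteq> U j"
    "\<And>j. j \<in> C \<Longrightarrow> emeasure lebesgue (U j) \<le> ennreal ((1 / 2) ^ i * vol (fst j) (10 * snd j))"
    by blast
  have near: "\<bar>mean (fst j) (10 * snd j) - c\<bar> \<le> step" if j: "j \<in> C" for j
  \<comment> \<open>If the tenfold radius is still admissible it exceeds twice the selected radius,
    hence is not bad. Otherwise \<rho> < 10 * snd j, and both balls are a fixed proportion of
    \<open>ball z (11 * \<rho>)\<close>.\<close>
  proof (cases "10 * snd j \<le> \<rho>")
    case True
    then show ?thesis using Cp(5)[OF j, of "10 * snd j"] Cp(1)[OF j] threshold_less_step by auto
  next
    case False
    have "\<bar>mean (fst j) (10 * snd j) - mean z (11 * \<rho>)\<bar> \<le> 11 ^ DIM('a) * K"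
      using False Cp(1-3)[OF j] \<rho> by (intro mean_diff) (auto simp: ball_subset_ball_iff dist_commute)
    moreover have "\<bar>mean z \<rho> - mean z (11 * \<rho>)\<bar> \<le> 11 ^ DIM('a) * K"
      using \<rho> by (intro mean_diff) (auto simp: ball_subset_ball_iff)
    ultimately show ?thesis using threshold_pos unfolding step_def c_def by linarith
  qed
  have sub: "{x \<in> ball z \<rho>. \<exists>r. 0 < r \<and> r \<le> \<rho> \<and> real (Suc i) * step < \<bar>mean x r - mean z \<rho>\<bar>} \<subseteq> (\<Union>j\<in>C. U j)"
  proof clarify
    fix x r assume x: "x \<in> ball z \<rho>" and r: "0 < r" "r \<le> \<rho>" and far: "real (Suc i) * step < \<bar>mean x r - mean z \<rho>\<bar>"
    \<comment> \<open>The bad radii of x, which include r since one step exceeds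
      \<open>threshold\<close>. The supremum need not be attained, so a radius s beyond half of it
      is chosen.\<close>
    define R where "R = {r. 0 < r \<and> r \<le> \<rho> \<and> threshold < \<bar>mean x r - c\<bar>}"
    have "1 * step \<le> real (Suc i) * step" using step_pos by (intro mult_right_mono) auto
    then have rR: "r \<in> R" using far r threshold_less_step by (auto simp: R_def c_def)
    have bdd: "bdd_above R" by (auto simp: R_def intro: bdd_aboveI[of _ \<rho>])
    have S: "s \<le> Sup R" if "s \<in> R" for s using that bdd by (rule cSup_upper)
    have "Sup R / 2 < Sup R" using S[OF rR] r by simp
    then obtain s where s: "s \<in> R" "Sup R / 2 < s" using less_cSup_iff[OF _ bdd] rR by blast
    have "\<bar>mean x r' - c\<bar> \<le> threshold" if "2 * s \<le> r'" "r' \<le> \<rho>" for r'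
    proof (rule ccontr)
      assume "\<not> \<bar>mean x r' - c\<bar> \<le> threshold"
      then have "r' \<in> R" using that s by (auto simp: R_def)
      then show False using S[of r'] s that by simp
    qed
    then have "(x, s) \<in> \<K>" using s x by (auto simp: \<K>_def R_def)
    then obtain j where j: "j \<in> C" "cball x s \<subseteq> ball (fst j) (5 * snd j)" using C(4) by fastforce
    have s5: "dist x (fst j) + s < 5 * snd j" using j(2) s by (auto simp: cball_subset_ball_iff R_def)
    \<comment> \<open>This is where ten arises: r \<le> Sup R < 2s, and s < 5 * snd j by
      Vitali.\<close>
    have "r < 10 * snd j" using S[OF rR] s s5 zero_le_dist[of x "fst j"] by linarith
    moreover have "x \<in> ball (fst j) (10 * snd j)"
      using s5 Cp(1)[OF j(1)] s by (auto simp: dist_commute R_def)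
    moreover have "real i * step < \<bar>mean x r - mean (fst j) (10 * snd j)\<bar>"
      using far near[OF j(1)] unfolding c_def by (simp add: algebra_simps)
    ultimately have "x \<in> U j" using U(2)[OF j(1)] r unfolding T_def by (auto intro!: exI[of _ r])
    then show "x \<in> (\<Union>j\<in>C. U j)" using j by blast
  qed
  have em: "emeasure lebesgue (\<Union>j\<in>C. U j) \<le> ennreal ((1 / 2) ^ Suc i * vol z \<rho>)"
  proof -
    let ?n = "DIM('a)"
    have "emeasure lebesgue (\<Union>j\<in>C. U j) \<le> (\<integral>\<^sup>+j. emeasure lebesgue (U j) \<partial>count_space C)"
      by (rule emeasure_UN_le_count_space) (use C(1) U(1) in auto)
    also have "\<dots> \<le> (\<integral>\<^sup>+j. ennreal ((1 / 2) ^ i * 10 ^ ?n / threshold) * (\<integral>\<^sup>+y\<in>ball (fst j) (snd j). ennreal \<bar>b y - c\<bar> \<partial>lebesgue) \<partial>count_space C)"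
    proof (intro nn_integral_mono)
      fix j assume "j \<in> space (count_space C)"
      then have j: "j \<in> C" by simp
      have "emeasure lebesgue (U j) \<le> ennreal ((1 / 2) ^ i * vol (fst j) (10 * snd j))" by (rule U(3)) fact
      also have "vol (fst j) (10 * snd j) = 10 ^ ?n * vol (fst j) (snd j)"
        using Cp(1)[OF j] by (intro measure_ball_scale) auto
      also have "(1 / 2) ^ i * (10 ^ ?n * vol (fst j) (snd j)) = ((1 / 2) ^ i * 10 ^ ?n / threshold) * (threshold * vol (fst j) (snd j))"
        using threshold_pos by simp
      also have "ennreal \<dots> = ennreal ((1 / 2) ^ i * 10 ^ ?n / threshold) * ennreal (threshold * vol (fst j) (snd j))"
        using threshold_pos by (intro ennreal_mult) auto
      also have "\<dots> \<le> ennreal ((1 / 2) ^ i * 10 ^ ?n / threshold) * ennreal (\<bar>mean (fst j) (snd j) - c\<bar> * vol (fst j) (snd j))"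
        using Cp(4)[OF j] by (intro mult_left_mono ennreal_leI mult_right_mono) auto
      also have "\<dots> \<le> ennreal ((1 / 2) ^ i * 10 ^ ?n / threshold) * (\<integral>\<^sup>+y\<in>ball (fst j) (snd j). ennreal \<bar>b y - c\<bar> \<partial>lebesgue)"
        using Cp(1)[OF j] by (intro mult_left_mono mean_dist) auto
      finally show "emeasure lebesgue (U j) \<le> \<dots>" .
    qed
    also have "\<dots> = ennreal ((1 / 2) ^ i * 10 ^ ?n / threshold) * (\<integral>\<^sup>+j. (\<integral>\<^sup>+y\<in>ball (fst j) (snd j). ennreal \<bar>b y - c\<bar> \<partial>lebesgue) \<partial>count_space C)"
      by (rule nn_integral_cmult) auto
    also have "(\<integral>\<^sup>+j. (\<integral>\<^sup>+y\<in>ball (fst j) (snd j). ennreal \<bar>b y - c\<bar> \<partial>lebesgue) \<partial>count_space C)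
       = (\<integral>\<^sup>+y\<in>(\<Union>j\<in>C. ball (fst j) (snd j)). ennreal \<bar>b y - c\<bar> \<partial>lebesgue)"
      by (rule nn_integral_UN_disjoint[symmetric]) (use C(1) disj in auto)
    also have "\<dots> \<le> (\<integral>\<^sup>+y\<in>ball z (2 * \<rho>). ennreal \<bar>b y - c\<bar> \<partial>lebesgue)"
    proof -
      have "ball (fst j) (snd j) \<subseteq> ball z (2 * \<rho>)" if "j \<in> C" for j
        using Cp(1-3)[OF that] by (auto simp: ball_subset_ball_iff dist_commute)
      then have "(\<Union>j\<in>C. ball (fst j) (snd j)) \<subseteq> ball z (2 * \<rho>)" by blast
      then show ?thesis by (rule nn_set_integral_set_mono)
    qed
    also have "\<dots> \<le> ennreal ((1 + 2 ^ ?n) * K * 2 ^ ?n * vol z \<rho>)"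
      unfolding c_def by (rule osc_double) fact
    also have "ennreal ((1 / 2) ^ i * 10 ^ ?n / threshold) * ennreal ((1 + 2 ^ ?n) * K * 2 ^ ?n * vol z \<rho>)
       = ennreal (((1 / 2) ^ i * 10 ^ ?n / threshold) * ((1 + 2 ^ ?n) * K * 2 ^ ?n * vol z \<rho>))"
      using threshold_pos K_pos by (intro ennreal_mult[symmetric]) (auto intro!: mult_nonneg_nonneg)
    also have "((1 / 2) ^ i * 10 ^ ?n / threshold) * ((1 + 2 ^ ?n) * K * 2 ^ ?n * vol z \<rho>) = (1 / 2) ^ Suc i * vol z \<rho>"
    proof -
      have "10 ^ ?n * ((1 + 2 ^ ?n) * K * 2 ^ ?n) * 2 = threshold"
        by (simp add: threshold_def power_mult_distrib[symmetric, of "10::real" 2] mult.commute mult.left_commute)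
           (simp add: algebra_simps flip: power_mult_distrib)
      then have half: "10 ^ ?n * ((1 + 2 ^ ?n) * K * 2 ^ ?n) / threshold = 1 / 2"
        using threshold_pos by (subst divide_eq_eq) (auto simp: mult_ac)
      have eq: "x * N / threshold * (M * v) = x * v * (N * M / threshold)" for x N M v :: real by simp
      show ?thesis unfolding eq half power_Suc by (simp only: mult_ac)
    qed
    finally show ?thesis by (simp add: mult_left_mono)
  qed
  have "(\<Union>j\<in>C. U j) \<in> sets lebesgue" using C(1) U(1) by (intro sets.countable_UN') auto
  then show ?case using sub em by (intro exI[of _ "\<Union>j\<in>C. U j"] conjI)
qed

text \<open>A layer-cake sum: W puts the weight F(2(i+1)step) on the cover of level i, whose measure
  decays like 2^-i. The factor 2 arises because the deviation of \<open>b x\<close> from a mean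
  around x splits into two deviations from \<open>mean z \<rho>\<close>. The covers admit every
  radius, so a single W serves all r and the later supremum over r costs nothing.\<close>

lemma oscillation_majorant:
  assumes F: "\<And>u v. 0 \<le> u \<Longrightarrow> u \<le> v \<Longrightarrow> F u \<le> F v" and \<rho>: "0 < \<rho>"
  obtains W where "W \<in> borel_measurable lebesgue"
    "(\<integral>\<^sup>+x. W x \<partial>lebesgue) \<le> ennreal (vol z \<rho>) * (\<Sum>i. ennreal (F (2 * (real i + 1) * step)) * ennreal ((1 / 2) ^ i))"
    "AE x in lebesgue. x \<in> ball z \<rho> \<longrightarrow> ennreal (F \<bar>b x - mean z \<rho>\<bar>) \<le> W x \<and>
       (\<forall>r. 0 < r \<and> r \<le> \<rho> \<longrightarrow> ennreal (F \<bar>b x - mean x r\<bar>) \<le> W x)"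
proof -
  define T where "T i = {x \<in> ball z \<rho>. \<exists>r. 0 < r \<and> r \<le> \<rho> \<and> real i * step < \<bar>mean x r - mean z \<rho>\<bar>}" for i :: nat
  have "\<forall>i. \<exists>U. U \<in> sets lebesgue \<and> T i \<subseteq> U \<and> emeasure lebesgue U \<le> ennreal ((1 / 2) ^ i * vol z \<rho>)"
    unfolding T_def using john_nirenberg_cover[OF \<rho>] by (intro allI)
  from choice[OF this] obtain V where V: "\<And>i. V i \<in> sets lebesgue" "\<And>i. T i \<subseteq> V i"
    "\<And>i. emeasure lebesgue (V i) \<le> ennreal ((1 / 2) ^ i * vol z \<rho>)"
    by blast
  \<comment> \<open>At level 0 the cover must be the whole ball, since points with deviation 0 also
    need weight F(2 step).\<close>
  define U where "U i = (if i = 0 then ball z \<rho> else V i)" for i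
  have Um[measurable]: "U i \<in> sets lebesgue" for i using V(1) by (simp add: U_def)
  have Ue: "emeasure lebesgue (U i) \<le> ennreal ((1 / 2) ^ i * vol z \<rho>)" for i
    using V(3)[of i] emeasure_ball_eq[of z \<rho>] by (cases "i = 0") (simp_all only: U_def simp_thms if_True if_False power_0 mult_1_left order_refl)
  define W where "W x = (\<Sum>i. ennreal (F (2 * (real i + 1) * step)) * indicator (U i) x)" for x
  have "W \<in> borel_measurable lebesgue" unfolding W_def by measurable
  moreover have "(\<integral>\<^sup>+x. W x \<partial>lebesgue) \<le> ennreal (vol z \<rho>) * (\<Sum>i. ennreal (F (2 * (real i + 1) * step)) * ennreal ((1 / 2) ^ i))"
  proof -
    have "(\<integral>\<^sup>+x. W x \<partial>lebesgue) = (\<Sum>i. \<integral>\<^sup>+x. ennreal (F (2 * (real i + 1) * step)) * indicator (U i) x \<partial>lebesgue)"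
      unfolding W_def by (rule nn_integral_suminf) measurable
    also have "\<dots> = (\<Sum>i. ennreal (F (2 * (real i + 1) * step)) * emeasure lebesgue (U i))"
      by (subst nn_integral_cmult_indicator) auto
    also have "\<dots> \<le> (\<Sum>i. ennreal (vol z \<rho>) * (ennreal (F (2 * (real i + 1) * step)) * ennreal ((1 / 2) ^ i)))"
    proof (intro suminf_le summableI)
      fix i
      have "emeasure lebesgue (U i) \<le> ennreal ((1 / 2) ^ i) * ennreal (vol z \<rho>)"
        using Ue[of i] by (simp add: ennreal_mult)
      then have "ennreal (F (2 * (real i + 1) * step)) * emeasure lebesgue (U i)
         \<le> ennreal (F (2 * (real i + 1) * step)) * (ennreal ((1 / 2) ^ i) * ennreal (vol z \<rho>))"
        by (intro mult_left_mono) auto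
      then show "ennreal (F (2 * (real i + 1) * step)) * emeasure lebesgue (U i)
         \<le> ennreal (vol z \<rho>) * (ennreal (F (2 * (real i + 1) * step)) * ennreal ((1 / 2) ^ i))"
        by (simp add: mult_ac)
    qed
    finally show ?thesis by simp
  qed
  moreover have "AE x in lebesgue. x \<in> ball z \<rho> \<longrightarrow> ennreal (F \<bar>b x - mean z \<rho>\<bar>) \<le> W x \<and>
       (\<forall>r. 0 < r \<and> r \<le> \<rho> \<longrightarrow> ennreal (F \<bar>b x - mean x r\<bar>) \<le> W x)"
    using AE_exists_small_ball_mean_far[OF meas loc]
  proof eventually_elim
    case (elim x)
    have key: "ennreal (F v) \<le> W x"
      if x: "x \<in> ball z \<rho>" and r: "0 < r" "r \<le> \<rho>" and v: "0 \<le> v" "v \<le> \<bar>b x - mean z \<rho>\<bar> + \<bar>mean x r - mean z \<rho>\<bar>" for r v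
    proof -
      define y where "y = max \<bar>b x - mean z \<rho>\<bar> \<bar>mean x r - mean z \<rho>\<bar>"
      \<comment> \<open>For y > 0 this is the index with i * step < y \<le> (i + 1) * step; for y =
        0 the value -1 is truncated to 0.\<close>
      define i where "i = nat (\<lceil>y / step\<rceil> - 1)"
      have y0: "0 \<le> y" by (simp add: y_def)
      have "y / step \<le> real i + 1" unfolding i_def by linarith
      then have yi: "y \<le> (real i + 1) * step" using step_pos by (simp add: field_simps)
      have "x \<in> U i"
      proof (cases "i = 0")
        case False
        then have "real i < y / step" unfolding i_def by linarith
        then have iy: "real i * step < y" using step_pos by (simp add: field_simps)
        have "\<exists>r. 0 < r \<and> r \<le> \<rho> \<and> real i * step < \<bar>mean x r - mean z \<rho>\<bar>"
        proof (cases "real i * step < \<bar>mean x r - mean z \<rho>\<bar>")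
          case False
          then have "real i * step < \<bar>b x - mean z \<rho>\<bar>" using iy by (auto simp: y_def max_def split: if_splits)
          \<comment> \<open>The deviation belongs to \<open>b x\<close> itself; almost everywhere it
            is matched by the mean over some ball of radius below \<rho>.\<close>
          then show ?thesis using elim \<rho> unfolding mean_def by (meson less_imp_le)
        qed (use r in auto)
        then show ?thesis using V(2)[of i] x False by (auto simp: U_def T_def)
      qed (use x in \<open>simp add: U_def\<close>)
      have "ennreal (F v) \<le> ennreal (F (2 * (real i + 1) * step))"
      proof (intro ennreal_leI F)
        show "v \<le> 2 * (real i + 1) * step" 
          using v(2) yi[unfolded y_def max.bounded_iff] unfolding mult.assoc by linarith
      qed (use v in simp)
      also have "\<dots> = (\<Sum>i\<in>{i}. ennreal (F (2 * (real i + 1) * step)) * indicator (U i) x)"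
        using \<open>x \<in> U i\<close> by simp
      also have "\<dots> \<le> W x" unfolding W_def by (rule sum_le_suminf) auto
      finally show ?thesis .
    qed
    show ?case
    proof (intro impI conjI allI)
      assume x: "x \<in> ball z \<rho>"
      show "ennreal (F \<bar>b x - mean z \<rho>\<bar>) \<le> W x" by (rule key[OF x, of \<rho>]) (use \<rho> in \<open>linarith+\<close>)
      fix r assume r: "0 < r \<and> r \<le> \<rho>"
      show "ennreal (F \<bar>b x - mean x r\<bar>) \<le> W x" by (rule key[OF x, of r]) (use r in \<open>linarith+\<close>)
    qed
  qed
  ultimately show ?thesis by (rule that)
qed

end

lemma BMO_imp_bmo_fun:
  assumes "b \<in> BMO" obtains K where "bmo_fun b K"
proof -
  obtain K where K: "\<And>x r. 0 < r \<Longrightarrow>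
    (LINT y:ball x r|lebesgue. \<bar>b y - ball_mean b (ball x r)\<bar>) / measure lebesgue (ball x r) \<le> K"
    using assms by (auto simp: BMO_def)
  have "bmo_fun b (max K 1)"
  proof
    fix x :: 'a and r :: real assume r: "0 < r"
    have "(LINT y:ball x r|lebesgue. \<bar>b y - ball_mean b (ball x r)\<bar>) / measure lebesgue (ball x r) \<le> max K 1"
      using K[OF r, of x] by linarith
    then show "(LINT y:ball x r|lebesgue. \<bar>b y - ball_mean b (ball x r)\<bar>) \<le> max K 1 * measure lebesgue (ball x r)"
      using measure_ball_pos[OF r, of x] by (simp add: pos_divide_le_eq)
  qed (use assms in \<open>auto simp: BMO_def\<close>)
  then show ?thesis by (rule that)
qed

section \<open>The modular estimate\<close>

text \<open>From x/d \<le> exp(x/d), the power is at most a multiple of exp(r x/d). The choice of d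
  makes this exponential grow by exactly 3/2 per index, which leaves ratio 3/4 against
  (1/2)^i.\<close>

lemma summable_powr_geometric:
  fixes a c r :: real
  assumes "0 < a" "0 \<le> c" "0 < r"
  shows "summable (\<lambda>i. (a * real i + c) powr r * (1 / 2) ^ i)"
proof (rule summable_comparison_test')
  define d where "d = r * a / ln (3 / 2)"
  have d: "0 < d" using assms by (simp add: d_def)
  show "summable (\<lambda>i. d powr r * exp (r * c / d) * (3 / 4 :: real) ^ i)"
    by (intro summable_mult summable_geometric) simp
  fix i :: nat
  let ?x = "a * real i + c"
  have x: "0 \<le> ?x" using assms by simp
  have "?x powr r = d powr r * (?x / d) powr r"
    using d x assms by (simp flip: powr_mult)
  also have "(?x / d) powr r \<le> exp (?x / d) powr r"
  proof (rule powr_mono2)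
    show "?x / d \<le> exp (?x / d)" using exp_ge_add_one_self[of "?x / d"] by linarith
    show "0 \<le> ?x / d" using x d by (rule divide_nonneg_pos)
  qed (use assms in simp)
  also have "exp (?x / d) powr r = exp (r * c / d) * exp (ln (3 / 2) * real i)"
    using d assms by (simp add: powr_def d_def field_simps flip: exp_add)
  also have "exp (ln (3 / 2) * real i) = (3 / 2 :: real) ^ i"
    by (simp add: exp_of_nat2_mult)
  finally have "?x powr r \<le> d powr r * (exp (r * c / d) * (3 / 2) ^ i)"
    using d by (simp add: mult_left_mono)
  then have "?x powr r * (1 / 2) ^ i \<le> d powr r * (exp (r * c / d) * (3 / 2) ^ i) * (1 / 2) ^ i"
    by (intro mult_right_mono) auto
  also have "\<dots> = d powr r * exp (r * c / d) * ((3 / 2) * (1 / 2)) ^ i"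
    by (simp only: power_mult_distrib mult.assoc)
  finally show "norm (?x powr r * (1 / 2) ^ i) \<le> d powr r * exp (r * c / d) * (3 / 4) ^ i"
    by simp
qed

lemma lacunary_power:
  fixes a :: "int \<Rightarrow> real"
  assumes "\<And>k. 2 * a k \<le> a (k + 1)"
  shows "2 ^ i * a k \<le> a (k + int i)"
proof (induction i)
  case (Suc i)
  have "2 ^ Suc i * a k \<le> 2 * a (k + int i)" using Suc by simp
  also have "\<dots> \<le> a (k + int i + 1)" by (rule assms)
  finally show ?case by (simp add: ac_simps)
qed simp

text \<open>Since a k at least doubles, the indices with a k < Y have a largest element m, and each
  step down from m at least halves a k / Y. The sum is therefore dominated by a geometric series,
  uniformly in a and Y.\<close>

lemma lacunary_sum:
  fixes a :: "int \<Rightarrow> real"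
  assumes pos: "\<And>k. 0 < a k" and lac: "\<And>k. 2 * a k \<le> a (k + 1)" and "0 < \<delta>" "0 < Y"
  shows "(\<integral>\<^sup>+k. ennreal (if a k < Y then (a k / Y) powr \<delta> else 0) \<partial>count_space UNIV)
    \<le> ennreal (1 / (1 - (1 / 2) powr \<delta>))"
proof (cases "\<exists>k. a k < Y")
  case True
  then obtain k0 where k0: "a k0 < Y" by blast
  \<comment> \<open>After N doublings a exceeds Y, as 2^N \<ge> N; the maximum m is thus found in a
    finite interval.\<close>
  obtain N :: nat where N: "Y / a k0 < real N" using reals_Archimedean2 by blast
  have bound: "k < k0 + int N" if "a k < Y" for k
  proof (rule ccontr)
    assume "\<not> k < k0 + int N"
    then obtain i where i: "k = k0 + int i" "N \<le> i"
      using that[of "nat (k - k0)"] by simp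
    have "real N \<le> 2 ^ i"
      using i(2) of_nat_less_two_power[of i, where 'a=real] by linarith
    then have "real N * a k0 \<le> 2 ^ i * a k0" using pos[of k0] by (intro mult_right_mono) auto
    also have "\<dots> \<le> a k" unfolding i(1) by (rule lacunary_power[of a, OF lac])
    finally show False using N that pos[of k0] by (simp add: field_simps)
  qed
  define S where "S = {k \<in> {k0..k0 + int N}. a k < Y}"
  have fS: "finite S" "k0 \<in> S" using k0 by (auto simp: S_def intro: finite_subset[of _ "{k0..k0 + int N}"])
  define m where "m = Max S"
  have "m \<in> S" unfolding m_def using fS by (intro Max_in) auto
  then have m: "a m < Y" by (simp add: S_def)
  have mle: "k \<le> m" if "a k < Y" for k
  proof (cases "k0 \<le> k")
    case True
    then have "k \<in> S" using bound[OF that] that by (simp add: S_def)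
    then show ?thesis using fS by (simp add: m_def)
  next
    case False
    then show ?thesis using Max_ge[OF fS] by (simp add: m_def)
  qed
  let ?q = "(1 / 2 :: real) powr \<delta>"
  have q: "0 < ?q" "?q < 1"
    using powr_less_mono2[of \<delta> "1/2" 1] assms by auto
  have bij: "bij_betw (\<lambda>i. m - int i) UNIV {..m}"
    by (rule bij_betwI[of _ _ _ "\<lambda>k. nat (m - k)"]) auto
  have "(\<integral>\<^sup>+k. ennreal (if a k < Y then (a k / Y) powr \<delta> else 0) \<partial>count_space UNIV)
     = (\<integral>\<^sup>+k. ennreal (if a k < Y then (a k / Y) powr \<delta> else 0) \<partial>count_space {..m})"
    using mle by (intro nn_integral_count_space_eq) (force simp: not_le[symmetric])+
  also have "\<dots> = (\<integral>\<^sup>+i. ennreal (if a (m - int i) < Y then (a (m - int i) / Y) powr \<delta> else 0) \<partial>count_space UNIV)"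
    by (rule nn_integral_bij_count_space[OF bij, symmetric])
  also have "\<dots> \<le> (\<integral>\<^sup>+i. ennreal (?q ^ i) \<partial>count_space UNIV)"
  proof (intro nn_integral_mono ennreal_leI)
    fix i
    have "2 ^ i * a (m - int i) \<le> a m" using lacunary_power[of a i "m - int i", OF lac] by simp
    then have "a (m - int i) / Y \<le> (1 / 2) ^ i"
      using m assms(4) by (simp add: field_simps)
    then have "(a (m - int i) / Y) powr \<delta> \<le> ((1 / 2) ^ i) powr \<delta>"
      using less_imp_le[OF pos[of "m - int i"]] assms(3,4) by (intro powr_mono2) auto
    also have "\<dots> = ?q ^ i"
      by (simp add: powr_powr mult.commute flip: powr_realpow)
    finally show "(if a (m - int i) < Y then (a (m - int i) / Y) powr \<delta> else 0) \<le> ?q ^ i"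
      using q by simp
  qed
  also have "\<dots> = (\<Sum>i. ennreal (?q ^ i))" by (rule nn_integral_count_space_nat)
  also have "\<dots> = ennreal (1 / (1 - ?q))"
    using q by (intro suminf_ennreal_eq geometric_sums) auto
  finally show ?thesis .
qed simp

lemma borel_measurable_nn_integral_count_space:
  assumes "countable I" and m: "\<And>i. i \<in> I \<Longrightarrow> f i \<in> borel_measurable M"
  shows "(\<lambda>x. \<integral>\<^sup>+i. f i x \<partial>count_space I) \<in> borel_measurable M"
proof -
  interpret sigma_finite_measure "count_space I"
    by (rule sigma_finite_measure_count_space_countable) fact
  have "(\<lambda>p. f (snd p) (fst p)) \<in> borel_measurable (M \<Otimes>\<^sub>M count_space I)"
    by (rule measurable_compose_countable'[where f = "\<lambda>i p. f i (fst p)" and g = snd])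
      (use assms in \<open>auto intro: measurable_compose[OF measurable_fst]\<close>)
  then show ?thesis
    by (intro borel_measurable_nn_integral) (simp add: case_prod_beta')
qed

text \<open>Here \<beta> plays the role of \<alpha>/n, and \<open>rel\<close> is the relation
  between the Young functions freed of inverses: for \<tau> = \<psi> v it says that the
  \<Phi>-inverse of \<tau> is v \<tau>^\<beta>.\<close>

locale comm_orlicz = bmo_fun b K + phi: doubling_convex \<phi> D\<phi> + psi: doubling_convex \<psi> D\<psi>
  for b :: "'a::euclidean_space \<Rightarrow> real" and K \<phi> D\<phi> \<psi> D\<psi> +
  fixes \<beta> p :: real
  assumes \<beta>: "0 \<le> \<beta>" and p: "1 < p"
    and lower: "\<And>t. 0 < t \<Longrightarrow> 2 powr p * \<phi> t \<le> \<phi> (2 * t)"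
    and rel: "\<And>v. 0 < v \<Longrightarrow> \<phi> (v * \<psi> v powr \<beta>) = \<psi> v"
begin

definition s :: real where "s = (1 + p) / 2"
definition s' :: real where "s' = s / (s - 1)"
text \<open>The constant that \<open>mass_le\<close> yields when \<phi> u0 is the reciprocal of the
  volume of the ball.\<close>

definition avg_const :: real where "avg_const = 1 + 2 powr p"
text \<open>In terms of the Young functions, \<open>lam\<close> is \<open>\<Phi>\<close> inverse composed with \<open>\<Psi>\<close>.\<close>
definition lam :: "real \<Rightarrow> real" where "lam v = v * \<psi> v powr \<beta>"
text \<open>The series bounds the mean of |b - b_B|^s' on any ball B; the added 1 is the share of
  |f|^s in the Young inequality of \<open>comm_average_le\<close>.\<close>

definition osc_const :: real where "osc_const = 1 + (\<Sum>i. (2 * (real i + 1) * step) powr s' * (1 / 2) ^ i)"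
definition q :: nat where "q = nat \<lceil>log 2 D\<psi>\<rceil>"
text \<open>Polynomial growth of \<psi>, of degree q, integrated against the exponential decay of
  the oscillation. The outermost 2 absorbs the spread of \<open>A\<close> within a dyadic
  level.\<close>

definition tail_const :: real where
  "tail_const = (\<Sum>i. D\<psi> * (2 * (2 * (2 * (real i + 1) * step) + osc_const)) ^ q * (1 / 2) ^ i)"

lemma s: "1 < s" "s < p" and s': "0 < s'" and avg_const: "1 < avg_const"
  using p by (auto simp: s_def s'_def avg_const_def)

lemma q: "D\<psi> \<le> 2 ^ q"
proof -
  have "log 2 D\<psi> \<le> real q" unfolding q_def by linarith
  then have "D\<psi> \<le> 2 powr real q" using psi.D_ge_2 by (simp add: log_le_iff)
  then show ?thesis by (simp add: powr_realpow)
qed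

lemma osc_summable: "summable (\<lambda>i. (2 * (real i + 1) * step) powr s' * (1 / 2) ^ i)"
  using summable_powr_geometric[of "2 * step" "2 * step" s'] step_pos s' by (simp add: algebra_simps)

lemma osc_const: "1 \<le> osc_const"
  unfolding osc_const_def using osc_summable by (simp add: suminf_nonneg)

lemma arg_ge_1:
  fixes u :: real
  assumes "0 \<le> u" shows "1 \<le> 2 * (2 * u + osc_const)"
  using assms osc_const by (simp add: algebra_simps)

lemma tail_summable: "summable (\<lambda>i. D\<psi> * (2 * (2 * (2 * (real i + 1) * step) + osc_const)) ^ q * (1 / 2) ^ i)"
proof -
  \<comment> \<open>The exponent q + 1 is visibly positive, and the base is at least 1, so raising
    the exponent only enlarges the terms.\<close>
  have "summable (\<lambda>i. D\<psi> * ((8 * step * real i + (8 * step + 2 * osc_const)) powr real (Suc q) * (1 / 2) ^ i))"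
    using step_pos osc_const by (intro summable_mult summable_powr_geometric) auto
  then show ?thesis
  proof (rule summable_comparison_test'[where N = 0])
    fix i :: nat
    have eq: "8 * step * real i + (8 * step + 2 * osc_const) = 2 * (2 * (2 * (real i + 1) * step) + osc_const)"
      by (simp add: algebra_simps)
    let ?y = "2 * (2 * (2 * (real i + 1) * step) + osc_const)"
    have y: "1 \<le> ?y" using step_pos by (intro arg_ge_1) simp
    have "?y ^ q \<le> ?y ^ Suc q" using y by (intro power_increasing) auto
    also have "\<dots> = ?y powr real (Suc q)" using y by (simp only: powr_realpow)
    finally have "?y ^ q \<le> ?y powr real (Suc q)" .
    then show "norm (D\<psi> * (2 * (2 * (2 * (real i + 1) * step) + osc_const)) ^ q * (1 / 2) ^ i)
       \<le> D\<psi> * ((8 * step * real i + (8 * step + 2 * osc_const)) powr real (Suc q) * (1 / 2) ^ i)"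
      unfolding eq using psi.D_ge_2 y by (simp only: real_norm_def abs_mult abs_of_nonneg) (simp add: mult.assoc mult_left_mono mult_right_mono)
  qed
qed

lemma tail_const: "0 \<le> tail_const"
  unfolding tail_const_def using tail_summable psi.D_ge_2 step_pos osc_const
  by (intro suminf_nonneg) (auto intro!: mult_nonneg_nonneg zero_le_power add_nonneg_nonneg)

lemma lam_pos: "0 < v \<Longrightarrow> 0 < lam v"
  using psi.pos[of v] by (simp add: lam_def)

lemma phi_lam: "0 < v \<Longrightarrow> \<phi> (lam v) = \<psi> v"
  unfolding lam_def by (rule rel)

lemma lam_double:
  assumes "0 < v" shows "2 * lam v \<le> lam (2 * v)"
proof -
  have "\<psi> v powr \<beta> \<le> \<psi> (2 * v) powr \<beta>"
    using assms \<beta> by (intro powr_mono2 psi.mono psi.nonneg) auto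
  then show ?thesis using assms by (simp add: lam_def)
qed

text \<open>Up to u0 the constant term suffices; beyond u0 the power s is dominated by p, and p by
  the growth of \<phi>. Integrated, it bounds |f|^s on a ball by the volume and the modular.\<close>

lemma powr_s_le:
  assumes "0 \<le> u" "0 < u0"
  shows "u powr s \<le> u0 powr s * (1 + 2 powr p * \<phi> u / \<phi> u0)"
proof (cases "u \<le> u0")
  case True
  have "u powr s \<le> u0 powr s * 1" using True assms s by (simp add: powr_mono2)
  also have "\<dots> \<le> u0 powr s * (1 + 2 powr p * \<phi> u / \<phi> u0)"
    using phi.pos[of u0] phi.nonneg[of u] assms by (intro mult_left_mono) auto
  finally show ?thesis .
next
  case False
  have "u powr s = u0 powr s * (u / u0) powr s" using assms by (simp add: powr_divide)
  also have "(u / u0) powr s \<le> (u / u0) powr p"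
    using False assms s by (intro powr_mono) auto
  also have "(u / u0) powr p \<le> 2 powr p * \<phi> u / \<phi> u0"
    using phi.growth_lower[OF p lower, of u0 u] False assms phi.pos[of u0] by (simp add: pos_le_divide_eq)
  also have "\<dots> \<le> 1 + 2 powr p * \<phi> u / \<phi> u0" by simp
  finally show ?thesis using assms by (simp add: mult_left_mono)
qed

lemma mean_oscillation_powr:
  assumes "0 < t"
  shows "(\<integral>\<^sup>+y\<in>ball x t. ennreal (\<bar>b y - mean x t\<bar> powr s') \<partial>lebesgue) \<le> ennreal ((osc_const - 1) * vol x t)"
proof -
  obtain W where W: "W \<in> borel_measurable lebesgue"
    "(\<integral>\<^sup>+x. W x \<partial>lebesgue) \<le> ennreal (vol x t) * (\<Sum>i. ennreal ((2 * (real i + 1) * step) powr s') * ennreal ((1 / 2) ^ i))"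
    "AE y in lebesgue. y \<in> ball x t \<longrightarrow> ennreal (\<bar>b y - mean x t\<bar> powr s') \<le> W y \<and>
       (\<forall>r. 0 < r \<and> r \<le> t \<longrightarrow> ennreal (\<bar>b y - mean y r\<bar> powr s') \<le> W y)"
    using oscillation_majorant[of "\<lambda>u. u powr s'" t x] assms s' by (auto simp: powr_mono2)
  have "(\<integral>\<^sup>+y\<in>ball x t. ennreal (\<bar>b y - mean x t\<bar> powr s') \<partial>lebesgue) \<le> (\<integral>\<^sup>+y. W y \<partial>lebesgue)"
    using W(3) by (intro nn_integral_mono_AE) (auto elim!: eventually_mono split: split_indicator)
  also note W(2)
  also have "(\<Sum>i. ennreal ((2 * (real i + 1) * step) powr s') * ennreal ((1 / 2) ^ i))
     = (\<Sum>i. ennreal ((2 * (real i + 1) * step) powr s' * (1 / 2) ^ i))"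
    by (simp add: ennreal_mult)
  also have "\<dots> = ennreal (osc_const - 1)"
    using osc_summable by (subst suminf_ennreal2) (auto simp: osc_const_def)
  also have "ennreal (vol x t) * ennreal (osc_const - 1) = ennreal ((osc_const - 1) * vol x t)"
    using osc_const by (subst ennreal_mult[symmetric]) (auto simp: mult.commute)
  finally show ?thesis .
qed

text \<open>Vitali's lemma requires bounded radii. For t \<ge> 1 the volume is at least t times that
  of the unit ball, which avoids roots; smaller t are covered by the maximum with 1.\<close>

lemma radius_bound:
  assumes "0 < t" "0 < w" "\<psi> w < 1 / vol x t"
  shows "t \<le> max 1 (1 / (\<psi> w * vol 0 1))"
proof (cases "1 \<le> t")
  case True
  have v0: "0 < vol 0 1" by (rule measure_ball_pos) simp
  have "vol x t = t ^ DIM('a) * vol 0 1" using measure_ball_scale[of 1 t x 0] assms by (simp only: mult_1_right zero_le_one less_imp_le)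
  moreover have "t \<le> t ^ DIM('a)" using True by (intro self_le_power) auto
  ultimately have le: "t * vol 0 1 \<le> vol x t" using v0 by (simp only: mult_right_mono less_imp_le)
  have "vol x t * \<psi> w < 1" using assms(3) measure_ball_pos[OF assms(1), of x] by (simp only: pos_less_divide_eq mult.commute)
  moreover have "t * vol 0 1 * \<psi> w \<le> vol x t * \<psi> w" using le psi.pos[OF assms(2)] by (intro mult_right_mono) auto
  ultimately have "t * (\<psi> w * vol 0 1) \<le> 1" by (simp only: mult.commute mult.left_commute mult.assoc)
  then have "t \<le> 1 / (\<psi> w * vol 0 1)" using v0 psi.pos[OF assms(2)] by (simp only: pos_le_divide_eq mult_pos_pos)
  then show ?thesis by simp
qed simp

end

section \<open>Ball averages of a normalised function and the dyadic levels\<close>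

locale normalized_orlicz = comm_orlicz b K \<phi> D\<phi> \<psi> D\<psi> \<beta> p
  for b :: "'a::euclidean_space \<Rightarrow> real" and K \<phi> D\<phi> \<psi> D\<psi> \<beta> p +
  fixes f :: "'a \<Rightarrow> real"
  assumes f_meas [measurable]: "f \<in> borel_measurable lebesgue"
    and modular: "(\<integral>\<^sup>+x. ennreal (\<phi> \<bar>f x\<bar>) \<partial>lebesgue) \<le> 1"
begin

definition mass :: "'a \<Rightarrow> real \<Rightarrow> ennreal" where
  "mass x t = (\<integral>\<^sup>+y\<in>ball x t. ennreal (\<bar>f y\<bar> powr s) \<partial>lebesgue)"
text \<open>The L^s average of f over the ball; \<open>enn2real\<close> loses nothing for positive
  radii by \<open>mass_finite\<close>.\<close>

definition \<nu> :: "'a \<Rightarrow> real \<Rightarrow> real" where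
  "\<nu> x t = (enn2real (mass x t) / vol x t) powr (1 / s)"
definition A :: "'a \<Rightarrow> real \<Rightarrow> real" where "A x t = vol x t powr \<beta> * \<nu> x t"
text \<open>The 2 in the truncation ensures that the discarded part of |f|^s is at most l^s /
  2.\<close>

definition large_part :: "real \<Rightarrow> 'a \<Rightarrow> ennreal" where
  "large_part l y = ennreal (if l < 2 * \<bar>f y\<bar> then \<bar>f y\<bar> powr s else 0)"

lemma phi_f_measurable [measurable]: "(\<lambda>x. \<phi> \<bar>f x\<bar>) \<in> borel_measurable lebesgue"
  by (rule measurable_compose[OF f_meas phi.borel_measurable_abs])

lemma large_part_measurable [measurable]: "large_part l \<in> borel_measurable lebesgue"
  unfolding large_part_def by measurable

lemma mass_le:
  assumes "0 < t" "0 < u0"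
  shows "mass x t \<le> ennreal (u0 powr s * (vol x t + 2 powr p / \<phi> u0))"
proof -
  let ?c = "u0 powr s * (2 powr p / \<phi> u0)"
  have c0: "0 \<le> ?c" using phi.pos[of u0] assms by simp
  have "mass x t \<le> (\<integral>\<^sup>+y. ennreal (u0 powr s) * indicator (ball x t) y + ennreal ?c * ennreal (\<phi> \<bar>f y\<bar>) \<partial>lebesgue)"
    unfolding mass_def
  proof (intro nn_integral_mono)
    fix y
    have "ennreal (\<bar>f y\<bar> powr s) \<le> ennreal (u0 powr s + ?c * \<phi> \<bar>f y\<bar>)"
      using powr_s_le[of "\<bar>f y\<bar>" u0] assms by (intro ennreal_leI) (simp add: algebra_simps)
    also have "\<dots> = ennreal (u0 powr s) + ennreal ?c * ennreal (\<phi> \<bar>f y\<bar>)"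
      using c0 phi.nonneg[of "\<bar>f y\<bar>"] by (simp only: ennreal_plus ennreal_mult powr_ge_zero mult_nonneg_nonneg abs_ge_zero)
    finally show "ennreal (\<bar>f y\<bar> powr s) * indicator (ball x t) y \<le> ennreal (u0 powr s) * indicator (ball x t) y + ennreal ?c * ennreal (\<phi> \<bar>f y\<bar>)"
      by (cases "y \<in> ball x t") simp_all
  qed
  also have "\<dots> = ennreal (u0 powr s) * emeasure lebesgue (ball x t) + ennreal ?c * (\<integral>\<^sup>+y. ennreal (\<phi> \<bar>f y\<bar>) \<partial>lebesgue)"
    by (subst nn_integral_add) (auto simp: nn_integral_cmult nn_integral_cmult_indicator)
  also have "\<dots> \<le> ennreal (u0 powr s) * ennreal (vol x t) + ennreal ?c * 1"
    unfolding emeasure_ball_eq using modular by (intro add_left_mono mult_left_mono) auto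
  also have "\<dots> = ennreal (u0 powr s * vol x t + ?c)"
    using c0 by (simp only: ennreal_mult[symmetric] ennreal_plus[symmetric] powr_ge_zero measure_nonneg mult_nonneg_nonneg mult_1_right)
  finally show ?thesis by (simp only: distrib_left)
qed

lemma mass_finite: "0 < t \<Longrightarrow> mass x t < \<infinity>"
  using mass_le[of t 1 x] by (simp add: le_less_trans)

lemma \<nu>_nonneg: "0 \<le> \<nu> x t"
  by (simp add: \<nu>_def)

lemma \<nu>_powr: "\<nu> x t powr s = enn2real (mass x t) / vol x t"
proof -
  have "0 \<le> enn2real (mass x t) / vol x t" by simp
  then show ?thesis unfolding \<nu>_def using s by (simp only: powr_powr) simp
qed

lemma mass_eq: "0 < t \<Longrightarrow> mass x t = ennreal (\<nu> x t powr s * vol x t)"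
  using mass_finite[of t x] measure_ball_pos[of t x] unfolding \<nu>_powr by (simp only: less_irrefl nonzero_divide_eq_eq) (simp add: less_top)

text \<open>For u0 the \<Phi>-inverse of 1/|B|, both terms of \<open>mass_le\<close> are multiples
  of u0^s |B|. This is the L^s counterpart of Jensen's bound for averages of functions of modular at
  most 1.\<close>

lemma \<nu>_le:
  assumes "0 < t" "0 < u0" "\<phi> u0 = 1 / vol x t"
  shows "\<nu> x t \<le> avg_const * u0"
proof -
  note V = measure_ball_pos[OF assms(1), of x]
  have "ennreal (\<nu> x t powr s * vol x t) \<le> ennreal (u0 powr s * (vol x t + 2 powr p / \<phi> u0))"
    unfolding mass_eq[OF assms(1), symmetric] using assms by (intro mass_le)
  also have "u0 powr s * (vol x t + 2 powr p / \<phi> u0) = u0 powr s * avg_const * vol x t"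
    unfolding assms(3) avg_const_def by (simp only: divide_divide_eq_right) (simp add: algebra_simps)
  finally have "\<nu> x t powr s * vol x t \<le> u0 powr s * avg_const * vol x t"
    using avg_const by (subst (asm) ennreal_le_iff) auto
  then have "\<nu> x t powr s \<le> u0 powr s * avg_const" using V by (simp only: mult_le_cancel_right_pos)
  also have "avg_const \<le> avg_const powr s" using avg_const s powr_mono[of 1 s avg_const] by simp
  then have "u0 powr s * avg_const \<le> (avg_const * u0) powr s"
    using assms(2) avg_const by (simp add: powr_mult mult.commute mult_right_mono)
  finally have "\<nu> x t powr s \<le> (avg_const * u0) powr s" .
  then show ?thesis using powr_le_cancel_iff s assms(2) avg_const \<nu>_nonneg
    by (metis linorder_not_less powr_less_mono2 less_trans mult_pos_pos not_less_iff_gr_or_eq zero_less_one less_imp_le)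
qed

text \<open>With \<tau> = 1/|B| and \<Phi>- and \<Psi>-inverses u0, w0 of \<tau>, \<open>rel\<close>
  gives u0 = w0 \<tau>^\<beta>. Since |B|^\<beta> \<tau>^\<beta> = 1, \<open>\<nu>_le\<close>
  becomes A \<le> avg_const * w0, so \<psi>(v / avg_const) < \<tau>. Using this as a lower bound for
  \<tau>^\<beta> eliminates |B| from v < |B|^\<beta> \<nu>.\<close>

lemma \<nu>_gt_lam:
  assumes "0 < t" "0 < v" "v < A x t"
  shows "lam (v / avg_const) < \<nu> x t" "\<psi> (v / avg_const) < 1 / vol x t"
proof -
  note V = measure_ball_pos[OF assms(1), of x]
  define \<tau> where "\<tau> = 1 / vol x t"
  have \<tau>: "0 < \<tau>" using V by (simp only: \<tau>_def zero_less_divide_1_iff)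
  have V\<tau>: "vol x t powr \<beta> * \<tau> powr \<beta> = 1"
    using V by (simp only: powr_mult[symmetric] \<tau>_def) simp
  obtain u0 where u0: "0 < u0" "\<phi> u0 = \<tau>" using phi.surj[OF \<tau>] .
  obtain w0 where w0: "0 < w0" "\<psi> w0 = \<tau>" using psi.surj[OF \<tau>] .
  have "\<phi> (lam w0) = \<phi> u0" using phi_lam w0 u0 by simp
  then have "lam w0 = u0" using phi.le_iff[of "lam w0" u0] phi.le_iff[of u0 "lam w0"] u0(1) lam_pos[OF w0(1)] by simp
  then have u0w0: "u0 = w0 * \<tau> powr \<beta>" by (simp add: lam_def w0)
  have "v < vol x t powr \<beta> * (avg_const * u0)"
    using assms(3) \<nu>_le[OF assms(1) u0(1)] u0(2) unfolding A_def \<tau>_def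
    by (smt (verit, best) mult_left_mono powr_ge_zero)
  also have "\<dots> = avg_const * w0 * (vol x t powr \<beta> * \<tau> powr \<beta>)" unfolding u0w0 by (simp only: mult_ac)
  finally have "v / avg_const < w0" using avg_const unfolding V\<tau> by (simp add: field_simps)
  then have \<psi>v: "\<psi> (v / avg_const) < \<tau>" using psi.less[of "v / avg_const" w0] w0 assms(2) avg_const by simp
  then show "\<psi> (v / avg_const) < 1 / vol x t" by (simp only: \<tau>_def)
  have "lam (v / avg_const) \<le> v / avg_const * \<tau> powr \<beta>"
    unfolding lam_def using \<psi>v assms(2) avg_const \<beta> by (intro mult_left_mono powr_mono2 psi.nonneg) auto
  also have "\<dots> < vol x t powr \<beta> * \<nu> x t / avg_const * \<tau> powr \<beta>"
    using assms(3) \<tau> avg_const unfolding A_def by (intro mult_strict_right_mono divide_strict_right_mono) auto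
  also have "\<dots> = \<nu> x t / avg_const * (vol x t powr \<beta> * \<tau> powr \<beta>)" by (simp only: mult_ac times_divide_eq_left times_divide_eq_right)
  also have "\<dots> \<le> \<nu> x t" unfolding V\<tau> using avg_const \<nu>_nonneg[of x t] by (simp add: divide_le_eq mult_left_mono[of 1 avg_const, simplified])
  finally show "lam (v / avg_const) < \<nu> x t" .
qed

text \<open>Summed over disjoint balls, this replaces the weak type bound of the maximal operator.\<close>
lemma vol_le_large_part:
  assumes "0 < t" "0 < l" "l < \<nu> x t"
  shows "ennreal (vol x t) \<le> ennreal (2 / l powr s) * (\<integral>\<^sup>+y\<in>ball x t. large_part l y \<partial>lebesgue)"
proof -
  let ?H = "\<integral>\<^sup>+y\<in>ball x t. large_part l y \<partial>lebesgue"
  have l0: "0 < l powr s" using assms by simp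
  have "ennreal (l powr s * vol x t) \<le> mass x t"
    unfolding mass_eq[OF assms(1)] using assms s by (intro ennreal_leI mult_right_mono powr_mono2) auto
  also have "\<dots> \<le> (\<integral>\<^sup>+y. large_part l y * indicator (ball x t) y + ennreal (l powr s / 2) * indicator (ball x t) y \<partial>lebesgue)"
    unfolding mass_def
  proof (intro nn_integral_mono)
    fix y
    \<comment> \<open>Where 2|f| \<le> l, s > 1 gives |f|^s \<le> (l/2)^s \<le> l^s / 2; over the
      ball this is half of the left-hand side and is absorbed.\<close>
    have "ennreal (\<bar>f y\<bar> powr s) \<le> large_part l y + ennreal (l powr s / 2)"
    proof (cases "l < 2 * \<bar>f y\<bar>")
      case False
      then have "\<bar>f y\<bar> powr s \<le> (l / 2) powr s" using s by (intro powr_mono2) auto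
      also have "\<dots> = l powr s / 2 powr s" using assms by (simp add: powr_divide)
      also have "\<dots> \<le> l powr s / 2" using s powr_mono[of 1 s 2] by (intro divide_left_mono) auto
      finally show ?thesis using False by (simp add: large_part_def ennreal_leI)
    qed (simp add: large_part_def)
    then show "ennreal (\<bar>f y\<bar> powr s) * indicator (ball x t) y
       \<le> large_part l y * indicator (ball x t) y + ennreal (l powr s / 2) * indicator (ball x t) y"
      by (cases "y \<in> ball x t") simp_all
  qed
  also have "\<dots> = ?H + ennreal (l powr s / 2) * emeasure lebesgue (ball x t)"
    by (subst nn_integral_add) (auto simp: nn_integral_cmult_indicator)
  also have "\<dots> = ?H + ennreal (l powr s / 2 * vol x t)"
    unfolding emeasure_ball_eq using l0 by (subst ennreal_mult) auto
  finally have le: "ennreal (l powr s * vol x t) \<le> ?H + ennreal (l powr s / 2 * vol x t)" .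
  show ?thesis
  proof (cases ?H)
    case (real r)
    have "ennreal (l powr s * vol x t) \<le> ennreal (r + l powr s / 2 * vol x t)"
      using le real l0 by (simp only: ennreal_plus mult_nonneg_nonneg measure_nonneg divide_nonneg_pos zero_less_numeral less_imp_le)
    then have "l powr s * vol x t \<le> r + l powr s / 2 * vol x t"
      using real(1) l0 by (subst (asm) ennreal_le_iff) (auto intro!: add_nonneg_nonneg)
    then have "vol x t \<le> 2 / l powr s * r" using l0 by (simp add: field_simps)
    then have "ennreal (vol x t) \<le> ennreal (2 / l powr s * r)" by (rule ennreal_leI)
    then show ?thesis unfolding real(2) using l0 real(1) by (subst ennreal_mult[symmetric]) auto
  next
    case top
    then show ?thesis using l0 by (simp add: ennreal_mult_top)
  qed
qed

text \<open>The L^s average of f that A > 2^k forces, by \<open>\<nu>_gt_lam\<close>.\<close>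

definition lev :: "int \<Rightarrow> real" where "lev k = lam (2 powr of_int k / avg_const)"

lemma lev_pos: "0 < lev k"
  unfolding lev_def using avg_const by (intro lam_pos) auto

lemma lev_double: "2 * lev k \<le> lev (k + 1)"
proof -
  have "2 powr of_int (k + 1) / avg_const = 2 * (2 powr of_int k / avg_const)" by (simp add: powr_add)
  then show ?thesis unfolding lev_def using avg_const lam_double[of "2 powr of_int k / avg_const"] by simp
qed

text \<open>Vitali's inclusion gives both that x lies in some fivefold ball and that t is at most
  its radius, so the majorant W of that one ball applies to the pair (x, t). Adding these majorants
  over the selected balls avoids choosing a ball for each x.\<close>

lemma level_majorant:
  obtains W where "W \<in> borel_measurable lebesgue"
    "(\<integral>\<^sup>+x. W x \<partial>lebesgue) \<le> ennreal (2 * 5 ^ DIM('a) * tail_const) * (ennreal (\<psi> (2 powr of_int k) / lev k powr s) * (\<integral>\<^sup>+y. large_part (lev k) y \<partial>lebesgue))"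
    "AE x in lebesgue. \<forall>t>0. 2 powr of_int k < A x t \<and> A x t \<le> 2 powr of_int (k + 1) \<longrightarrow>
       ennreal (\<psi> ((2 * \<bar>b x - mean x t\<bar> + osc_const) * A x t)) \<le> W x"
proof -
  let ?n = "DIM('a)"
  let ?v = "2 powr of_int k :: real"
  define \<K> where "\<K> = {(x, t). 0 < t \<and> ?v < A x t \<and> A x t \<le> 2 powr of_int (k + 1)}"
  have v0: "0 < ?v / avg_const" using avg_const by simp
  \<comment> \<open>A > 2^k bounds the volume from above, by a constant depending on k
    alone.\<close>
  have \<K>r: "0 < snd i \<and> snd i \<le> max 1 (1 / (\<psi> (?v / avg_const) * vol 0 1))" if "i \<in> \<K>" for i
  proof -
    have i: "0 < snd i" "?v < A (fst i) (snd i)" using that by (auto simp: \<K>_def)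
    then show ?thesis using radius_bound[OF i(1) v0 \<nu>_gt_lam(2)[OF i(1) _ i(2)]] by simp
  qed
  obtain C where C: "countable C" "C \<subseteq> \<K>"
     "pairwise (\<lambda>i j. disjnt (cball (fst i) (snd i)) (cball (fst j) (snd j))) C"
     "\<And>i. i \<in> \<K> \<Longrightarrow> \<exists>j. j \<in> C \<and>
        \<not> disjnt (cball (fst i) (snd i)) (cball (fst j) (snd j)) \<and> cball (fst i) (snd i) \<subseteq> ball (fst j) (5 * snd j)"
    by (rule Vitali_covering_lemma_cballs_balls[of \<K> snd _ fst, OF \<K>r]) (assumption, rule that)
  have Cp: "0 < snd j" "lev k < \<nu> (fst j) (snd j)" if "j \<in> C" for j
  proof -
    have j: "0 < snd j" "?v < A (fst j) (snd j)" using that C(2) by (auto simp: \<K>_def)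
    show "0 < snd j" by fact
    show "lev k < \<nu> (fst j) (snd j)" unfolding lev_def by (rule \<nu>_gt_lam(1)) (use j in auto)
  qed
  have disj: "pairwise (\<lambda>i j. disjnt (ball (fst i) (snd i)) (ball (fst j) (snd j))) C"
    using C(3) by (rule pairwise_mono) (meson ball_subset_cball disjnt_subset1 disjnt_subset2, simp)
  \<comment> \<open>\<open>A\<close> is replaced by 2^(k+1), its upper bound on the level, so that F
    depends on the oscillation only.\<close>
  define F where "F u = \<psi> (2 * (2 * u + osc_const) * ?v)" for u
  have Fmono: "F u \<le> F v" if "0 \<le> u" "u \<le> v" for u v
    unfolding F_def using that osc_const by (intro psi.mono mult_right_mono) auto
  have Fsum: "(\<Sum>i. ennreal (F (2 * (real i + 1) * step)) * ennreal ((1 / 2) ^ i)) \<le> ennreal (tail_const * \<psi> ?v)"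
  proof -
    have "(\<Sum>i. ennreal (F (2 * (real i + 1) * step)) * ennreal ((1 / 2) ^ i))
       \<le> (\<Sum>i. ennreal (D\<psi> * (2 * (2 * (2 * (real i + 1) * step) + osc_const)) ^ q * (1 / 2) ^ i) * ennreal (\<psi> ?v))"
    proof (intro suminf_le summableI)
      fix i
      let ?y = "2 * (2 * (2 * (real i + 1) * step) + osc_const)"
      have y: "1 \<le> ?y" using step_pos by (intro arg_ge_1) simp
      have "F (2 * (real i + 1) * step) \<le> D\<psi> * ?y ^ q * \<psi> ?v"
        unfolding F_def by (rule psi.growth_upper[OF q _ y]) simp
      then have "ennreal (F (2 * (real i + 1) * step)) * ennreal ((1 / 2) ^ i) \<le> ennreal (D\<psi> * ?y ^ q * \<psi> ?v) * ennreal ((1 / 2) ^ i)"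
        by (intro mult_right_mono ennreal_leI) auto
      also have "\<dots> = ennreal (D\<psi> * ?y ^ q * (1 / 2) ^ i) * ennreal (\<psi> ?v)"
        using psi.D_ge_2 y psi.nonneg[of ?v] by (subst (1 2) ennreal_mult[symmetric]) (auto simp: mult_ac)
      finally show "ennreal (F (2 * (real i + 1) * step)) * ennreal ((1 / 2) ^ i) \<le> \<dots>" .
    qed
    also have "\<dots> = (\<Sum>i. ennreal (D\<psi> * (2 * (2 * (2 * (real i + 1) * step) + osc_const)) ^ q * (1 / 2) ^ i)) * ennreal (\<psi> ?v)"
      by (rule ennreal_suminf_multc)
    also have "(\<Sum>i. ennreal (D\<psi> * (2 * (2 * (2 * (real i + 1) * step) + osc_const)) ^ q * (1 / 2) ^ i)) = ennreal tail_const"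
      unfolding tail_const_def using tail_summable psi.D_ge_2 step_pos osc_const
      by (intro suminf_ennreal2) (auto intro!: mult_nonneg_nonneg zero_le_power add_nonneg_nonneg)
    also have "ennreal tail_const * ennreal (\<psi> ?v) = ennreal (tail_const * \<psi> ?v)"
      using tail_const psi.nonneg[of ?v] by (simp add: ennreal_mult)
    finally show ?thesis .
  qed
  have "\<forall>j\<in>C. \<exists>W. W \<in> borel_measurable lebesgue \<and>
    (\<integral>\<^sup>+x. W x \<partial>lebesgue) \<le> ennreal (vol (fst j) (5 * snd j)) * (\<Sum>i. ennreal (F (2 * (real i + 1) * step)) * ennreal ((1 / 2) ^ i)) \<and>
    (AE x in lebesgue. x \<in> ball (fst j) (5 * snd j) \<longrightarrow> ennreal (F \<bar>b x - mean (fst j) (5 * snd j)\<bar>) \<le> W x \<and>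
       (\<forall>r. 0 < r \<and> r \<le> 5 * snd j \<longrightarrow> ennreal (F \<bar>b x - mean x r\<bar>) \<le> W x))"
  proof
    fix j assume "j \<in> C"
    then have r: "0 < 5 * snd j" using Cp(1) by simp
    obtain W where "W \<in> borel_measurable lebesgue"
      "(\<integral>\<^sup>+x. W x \<partial>lebesgue) \<le> ennreal (vol (fst j) (5 * snd j)) * (\<Sum>i. ennreal (F (2 * (real i + 1) * step)) * ennreal ((1 / 2) ^ i))"
      "AE x in lebesgue. x \<in> ball (fst j) (5 * snd j) \<longrightarrow> ennreal (F \<bar>b x - mean (fst j) (5 * snd j)\<bar>) \<le> W x \<and>
       (\<forall>r. 0 < r \<and> r \<le> 5 * snd j \<longrightarrow> ennreal (F \<bar>b x - mean x r\<bar>) \<le> W x)"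
      by (rule oscillation_majorant[of F, OF Fmono r]) (assumption, assumption, rule that)
    then show "\<exists>W. W \<in> borel_measurable lebesgue \<and>
      (\<integral>\<^sup>+x. W x \<partial>lebesgue) \<le> ennreal (vol (fst j) (5 * snd j)) * (\<Sum>i. ennreal (F (2 * (real i + 1) * step)) * ennreal ((1 / 2) ^ i)) \<and>
      (AE x in lebesgue. x \<in> ball (fst j) (5 * snd j) \<longrightarrow> ennreal (F \<bar>b x - mean (fst j) (5 * snd j)\<bar>) \<le> W x \<and>
       (\<forall>r. 0 < r \<and> r \<le> 5 * snd j \<longrightarrow> ennreal (F \<bar>b x - mean x r\<bar>) \<le> W x))"
      by (intro exI[of _ W] conjI)
  qed
  from bchoice[OF this] obtain W where W: "\<And>j. j \<in> C \<Longrightarrow> W j \<in> borel_measurable lebesgue"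
    "\<And>j. j \<in> C \<Longrightarrow> (\<integral>\<^sup>+x. W j x \<partial>lebesgue) \<le> ennreal (vol (fst j) (5 * snd j)) * (\<Sum>i. ennreal (F (2 * (real i + 1) * step)) * ennreal ((1 / 2) ^ i))"
    "\<And>j. j \<in> C \<Longrightarrow> AE x in lebesgue. x \<in> ball (fst j) (5 * snd j) \<longrightarrow> ennreal (F \<bar>b x - mean (fst j) (5 * snd j)\<bar>) \<le> W j x \<and>
       (\<forall>r. 0 < r \<and> r \<le> 5 * snd j \<longrightarrow> ennreal (F \<bar>b x - mean x r\<bar>) \<le> W j x)"
    by blast
  define G where "G x = (\<integral>\<^sup>+j. W j x \<partial>count_space C)" for x
  have 1: "G \<in> borel_measurable lebesgue"
    unfolding G_def using C(1) W(1) by (rule borel_measurable_nn_integral_count_space)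
  let ?c = "ennreal (2 * 5 ^ ?n * tail_const * (\<psi> ?v / lev k powr s))"
  have l0: "0 < lev k powr s" using lev_pos[of k] by simp
  have p0: "0 \<le> \<psi> ?v" by (rule psi.nonneg) simp
  have "(\<integral>\<^sup>+x. G x \<partial>lebesgue) = (\<integral>\<^sup>+j. \<integral>\<^sup>+x. W j x \<partial>lebesgue \<partial>count_space C)"
    unfolding G_def using C(1) W(1) by (rule nn_integral_count_space_nn_integral)
  also have "\<dots> \<le> (\<integral>\<^sup>+j. ?c * (\<integral>\<^sup>+y\<in>ball (fst j) (snd j). large_part (lev k) y \<partial>lebesgue) \<partial>count_space C)"
  proof (intro nn_integral_mono)
    fix j assume "j \<in> space (count_space C)"
    then have j: "j \<in> C" by simp
    have "(\<integral>\<^sup>+x. W j x \<partial>lebesgue) \<le> ennreal (vol (fst j) (5 * snd j)) * ennreal (tail_const * \<psi> ?v)"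
      by (rule order_trans[OF W(2)[OF j]]) (intro mult_left_mono Fsum, simp)
    also have "vol (fst j) (5 * snd j) = 5 ^ ?n * vol (fst j) (snd j)"
      using Cp(1)[OF j] by (intro measure_ball_scale) auto
    also have "ennreal (5 ^ ?n * vol (fst j) (snd j)) * ennreal (tail_const * \<psi> ?v) = ennreal (5 ^ ?n * (tail_const * \<psi> ?v)) * ennreal (vol (fst j) (snd j))"
      using tail_const p0 by (subst (1 2) ennreal_mult[symmetric]) (auto simp: mult_ac)
    also have "\<dots> \<le> ennreal (5 ^ ?n * (tail_const * \<psi> ?v)) * (ennreal (2 / lev k powr s) * (\<integral>\<^sup>+y\<in>ball (fst j) (snd j). large_part (lev k) y \<partial>lebesgue))"
      by (intro mult_left_mono vol_le_large_part Cp j lev_pos) auto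
    also have "\<dots> = ?c * (\<integral>\<^sup>+y\<in>ball (fst j) (snd j). large_part (lev k) y \<partial>lebesgue)"
    proof -
      have "ennreal (5 ^ ?n * (tail_const * \<psi> ?v)) * ennreal (2 / lev k powr s) = ?c"
        using tail_const p0 l0 by (subst ennreal_mult[symmetric]) (auto simp: mult_ac)
      then show ?thesis by (simp only: mult.assoc[symmetric])
    qed
    finally show "(\<integral>\<^sup>+x. W j x \<partial>lebesgue) \<le> \<dots>" .
  qed
  also have "\<dots> = ?c * (\<integral>\<^sup>+j. (\<integral>\<^sup>+y\<in>ball (fst j) (snd j). large_part (lev k) y \<partial>lebesgue) \<partial>count_space C)"
    by (rule nn_integral_cmult) simp
  also have "(\<integral>\<^sup>+j. (\<integral>\<^sup>+y\<in>ball (fst j) (snd j). large_part (lev k) y \<partial>lebesgue) \<partial>count_space C)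
      = (\<integral>\<^sup>+y\<in>(\<Union>j\<in>C. ball (fst j) (snd j)). large_part (lev k) y \<partial>lebesgue)"
    by (rule nn_integral_UN_disjoint[symmetric]) (use C(1) disj in auto)
  also have "\<dots> \<le> (\<integral>\<^sup>+y\<in>UNIV. large_part (lev k) y \<partial>lebesgue)"
    by (rule nn_set_integral_set_mono) simp
  also have "?c = ennreal (2 * 5 ^ ?n * tail_const) * ennreal (\<psi> ?v / lev k powr s)"
    using tail_const p0 l0 by (intro ennreal_mult) auto
  finally have 2: "(\<integral>\<^sup>+x. G x \<partial>lebesgue) \<le> ennreal (2 * 5 ^ ?n * tail_const) * (ennreal (\<psi> ?v / lev k powr s) * (\<integral>\<^sup>+y. large_part (lev k) y \<partial>lebesgue))"
    by (simp add: mult_left_mono mult.assoc)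
  have "AE x in lebesgue. \<forall>j\<in>C. x \<in> ball (fst j) (5 * snd j) \<longrightarrow> ennreal (F \<bar>b x - mean (fst j) (5 * snd j)\<bar>) \<le> W j x \<and>
       (\<forall>r. 0 < r \<and> r \<le> 5 * snd j \<longrightarrow> ennreal (F \<bar>b x - mean x r\<bar>) \<le> W j x)"
    unfolding AE_ball_countable[OF C(1)] by (intro ballI W(3))
  then have 3: "AE x in lebesgue. \<forall>t>0. 2 powr of_int k < A x t \<and> A x t \<le> 2 powr of_int (k + 1) \<longrightarrow>
       ennreal (\<psi> ((2 * \<bar>b x - mean x t\<bar> + osc_const) * A x t)) \<le> G x"
  proof (rule eventually_mono, intro allI impI)
    fix x t
    assume x: "\<forall>j\<in>C. x \<in> ball (fst j) (5 * snd j) \<longrightarrow> ennreal (F \<bar>b x - mean (fst j) (5 * snd j)\<bar>) \<le> W j x \<and>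
       (\<forall>r. 0 < r \<and> r \<le> 5 * snd j \<longrightarrow> ennreal (F \<bar>b x - mean x r\<bar>) \<le> W j x)"
      and t: "0 < t" and At: "2 powr of_int k < A x t \<and> A x t \<le> 2 powr of_int (k + 1)"
    have "(x, t) \<in> \<K>" using t At by (simp add: \<K>_def)
    then obtain j where j: "j \<in> C" "cball x t \<subseteq> ball (fst j) (5 * snd j)" using C(4) by fastforce
    have d: "dist x (fst j) + t < 5 * snd j" using j(2) t by (simp add: cball_subset_ball_iff)
    have "x \<in> ball (fst j) (5 * snd j)" using d t by (simp add: dist_commute)
    moreover have "t \<le> 5 * snd j" using d zero_le_dist[of x "fst j"] by linarith
    ultimately have Wj: "ennreal (F \<bar>b x - mean x t\<bar>) \<le> W j x" using x j(1) t by blast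
    have "A x t \<le> 2 * ?v" using At by (simp add: powr_add)
    then have "(2 * \<bar>b x - mean x t\<bar> + osc_const) * A x t \<le> (2 * \<bar>b x - mean x t\<bar> + osc_const) * (2 * ?v)"
      using osc_const by (intro mult_left_mono) auto
    also have "\<dots> = 2 * (2 * \<bar>b x - mean x t\<bar> + osc_const) * ?v" by (simp only: mult_ac)
    finally have "\<psi> ((2 * \<bar>b x - mean x t\<bar> + osc_const) * A x t) \<le> F \<bar>b x - mean x t\<bar>"
      unfolding F_def using osc_const At by (intro psi.mono) (auto simp: A_def \<nu>_nonneg)
    then have "ennreal (\<psi> ((2 * \<bar>b x - mean x t\<bar> + osc_const) * A x t)) \<le> W j x"
      using Wj ennreal_leI order_trans by blast
    also have "W j x \<le> G x" unfolding G_def by (rule nn_integral_ge_point) fact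
    finally show "ennreal (\<psi> ((2 * \<bar>b x - mean x t\<bar> + osc_const) * A x t)) \<le> G x" .
  qed
  show ?thesis by (rule that[OF 1 2 3])
qed

end

section \<open>Summation over the levels\<close>

context comm_orlicz
begin

text \<open>The factors of \<open>level_term\<close>: D\<psi> avg_const^q to pass from \<psi>(2^k)
  to \<phi>(lev k), 2^p from \<open>growth_lower\<close>, and D\<phi> for doubling the argument
  y.\<close>

definition term_const :: real where "term_const = D\<psi> * avg_const ^ q * 2 powr p * D\<phi>"
definition sum_const :: real where "sum_const = term_const * (1 / (1 - (1 / 2) powr (p - s)))"
definition modular_const :: real where "modular_const = 2 * 5 ^ DIM('a) * tail_const * sum_const"

lemma term_const: "0 \<le> term_const"
  unfolding term_const_def using psi.D_ge_2 phi.D_ge_2 avg_const by simp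

lemma geometric_pos: "0 < 1 - (1 / 2 :: real) powr (p - s)"
  using powr_less_mono2[of "p - s" "1 / 2" 1] s by simp

lemma sum_const: "0 \<le> sum_const"
  unfolding sum_const_def using term_const geometric_pos by simp

lemma modular_const: "0 \<le> modular_const"
  unfolding modular_const_def using sum_const tail_const by simp

end

context normalized_orlicz
begin

text \<open>\<psi>(2^k) is at most a constant times \<psi>(2^k / avg_const) = \<phi>(lev k), which
  is at most a constant times (lev k / Y)^p \<phi>(y). Dividing by (lev k)^s leaves the positive
  power p - s. Y = 2y matches the truncation in \<open>large_part\<close>.\<close>

lemma level_term:
  assumes "lev k < Y" "0 < y" "Y = 2 * y"
  shows "\<psi> (2 powr of_int k) / lev k powr s * y powr s \<le> term_const * \<phi> y * (lev k / Y) powr (p - s)"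
proof -
  let ?v = "2 powr of_int k :: real"
  let ?l = "lev k"
  have l: "0 < ?l" by (rule lev_pos)
  have v: "0 < ?v / avg_const" using avg_const by simp
  have "\<psi> ?v = \<psi> (avg_const * (?v / avg_const))" using avg_const by simp
  also have "\<dots> \<le> D\<psi> * avg_const ^ q * \<psi> (?v / avg_const)"
    using psi.growth_upper[OF q v, of avg_const] avg_const by simp
  also have "\<psi> (?v / avg_const) = \<phi> ?l" unfolding lev_def using phi_lam[OF v] by simp
  finally have 1: "\<psi> ?v \<le> D\<psi> * avg_const ^ q * \<phi> ?l" .
  have "(Y / ?l) powr p * \<phi> ?l \<le> 2 powr p * \<phi> Y"
    by (rule phi.growth_lower[OF p lower l less_imp_le[OF assms(1)]])
  then have "\<phi> ?l \<le> 2 powr p * \<phi> Y * (?l / Y) powr p"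
    using l assms by (simp add: powr_divide field_simps)
  also have "\<dots> \<le> 2 powr p * (D\<phi> * \<phi> y) * (?l / Y) powr p"
    unfolding assms(3) using phi.doubling[OF assms(2)] by (intro mult_left_mono mult_right_mono) auto
  finally have 2: "\<phi> ?l \<le> 2 powr p * (D\<phi> * \<phi> y) * (?l / Y) powr p" .
  have D0: "0 \<le> D\<psi> * avg_const ^ q" using psi.D_ge_2 avg_const by simp
  have 3: "\<psi> ?v \<le> term_const * \<phi> y * (?l / Y) powr p"
    using order_trans[OF 1 mult_left_mono[OF 2 D0]] by (simp add: term_const_def mult_ac)
  have "y powr s / ?l powr s \<le> Y powr s / ?l powr s"
    unfolding assms(3) using assms(2) s by (intro divide_right_mono powr_mono2) auto
  also have "\<dots> = (?l / Y) powr (- s)"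
    using l assms by (simp add: powr_minus powr_divide)
  finally have 4: "y powr s / ?l powr s \<le> (?l / Y) powr (- s)" .
  have "\<psi> ?v / ?l powr s * y powr s = \<psi> ?v * (y powr s / ?l powr s)" by simp
  also have "\<dots> \<le> term_const * \<phi> y * (?l / Y) powr p * (?l / Y) powr (- s)"
    using 3 4 term_const phi.nonneg[of y] assms(2) by (intro mult_mono) auto
  also have "\<dots> = term_const * \<phi> y * (?l / Y) powr (p - s)"
    by (simp add: powr_diff powr_minus divide_inverse)
  finally show ?thesis .
qed

text \<open>A point sees only the levels with lev k < 2|f x|, and \<open>lev\<close> at least
  doubles from one level to the next, so \<open>lacunary_sum\<close> applies with exponent p -
  s.\<close>

lemma level_sum:
  "(\<integral>\<^sup>+k. ennreal (\<psi> (2 powr of_int k) / lev k powr s) * large_part (lev k) x \<partial>count_space UNIV) \<le> ennreal sum_const * ennreal (\<phi> \<bar>f x\<bar>)"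
proof (cases "f x = 0")
  case True
  then have "large_part (lev k) x = 0" for k using lev_pos[of k] by (simp add: large_part_def)
  then show ?thesis by simp
next
  case False
  define y where "y = \<bar>f x\<bar>"
  have y: "0 < y" using False by (simp add: y_def)
  have c: "0 \<le> term_const * \<phi> y" using term_const phi.nonneg[of y] y by simp
  have "(\<integral>\<^sup>+k. ennreal (\<psi> (2 powr of_int k) / lev k powr s) * large_part (lev k) x \<partial>count_space UNIV)
    \<le> (\<integral>\<^sup>+k. ennreal (term_const * \<phi> y) * ennreal (if lev k < 2 * y then (lev k / (2 * y)) powr (p - s) else 0) \<partial>count_space UNIV)"
  proof (intro nn_integral_mono)
    fix k :: int
    have p0: "0 \<le> \<psi> (2 powr of_int k) / lev k powr s" by (intro divide_nonneg_nonneg psi.nonneg) auto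
    show "ennreal (\<psi> (2 powr of_int k) / lev k powr s) * large_part (lev k) x
      \<le> ennreal (term_const * \<phi> y) * ennreal (if lev k < 2 * y then (lev k / (2 * y)) powr (p - s) else 0)"
    proof (cases "lev k < 2 * y")
      case True
      then have "ennreal (\<psi> (2 powr of_int k) / lev k powr s) * large_part (lev k) x = ennreal (\<psi> (2 powr of_int k) / lev k powr s * y powr s)"
        using p0 by (subst ennreal_mult) (auto simp: large_part_def y_def)
      also have "\<dots> \<le> ennreal (term_const * \<phi> y * (lev k / (2 * y)) powr (p - s))"
        using True y by (intro ennreal_leI level_term) auto
      also have "\<dots> = ennreal (term_const * \<phi> y) * ennreal ((lev k / (2 * y)) powr (p - s))"
        using c by (intro ennreal_mult) auto
      finally show ?thesis using True by simp
    qed (simp add: large_part_def y_def)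
  qed
  also have "\<dots> = ennreal (term_const * \<phi> y) * (\<integral>\<^sup>+k. ennreal (if lev k < 2 * y then (lev k / (2 * y)) powr (p - s) else 0) \<partial>count_space UNIV)"
    by (rule nn_integral_cmult) simp
  also have "\<dots> \<le> ennreal (term_const * \<phi> y) * ennreal (1 / (1 - (1 / 2) powr (p - s)))"
    using y s by (intro mult_left_mono lacunary_sum lev_pos lev_double) auto
  also have "\<dots> = ennreal sum_const * ennreal (\<phi> y)"
    using c sum_const geometric_pos phi.nonneg[of y] y by (subst (1 2) ennreal_mult[symmetric]) (auto simp: sum_const_def)
  finally show ?thesis by (simp add: y_def)
qed

text \<open>Hoelder's inequality in pointwise form: after dividing f by its own L^s average n, every
  term of \<open>pw\<close> integrates to a multiple of n |B|. For n = 0 this division is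
  impossible, but then f vanishes almost everywhere on the ball.\<close>

lemma comm_average_le:
  assumes t: "0 < t"
  shows "ennreal (vol x t powr (\<beta> - 1)) * (\<integral>\<^sup>+y\<in>ball x t. ennreal (\<bar>b x - b y\<bar> * \<bar>f y\<bar>) \<partial>lebesgue)
    \<le> ennreal ((2 * \<bar>b x - mean x t\<bar> + osc_const) * A x t)"
proof -
  note V = measure_ball_pos[OF t, of x]
  let ?I = "\<integral>\<^sup>+y\<in>ball x t. ennreal (\<bar>b x - b y\<bar> * \<bar>f y\<bar>) \<partial>lebesgue"
  define n where "n = \<nu> x t"
  define d where "d = \<bar>b x - mean x t\<bar>"
  have d0: "0 \<le> d" by (simp add: d_def)
  have I: "?I \<le> ennreal ((2 * d + osc_const) * (n * vol x t))"
  proof (cases "n = 0")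
    case True
    then have "mass x t = 0" using mass_eq[OF t, of x] s by (simp add: n_def)
    then have "AE y in lebesgue. ennreal (\<bar>f y\<bar> powr s) * indicator (ball x t) y = 0"
      unfolding mass_def by (subst (asm) nn_integral_0_iff_AE) auto
    then have "AE y in lebesgue. ennreal (\<bar>b x - b y\<bar> * \<bar>f y\<bar>) * indicator (ball x t) y = 0"
      by (rule eventually_mono) (auto split: split_indicator_asm)
    then have "?I = 0" by (subst nn_integral_0_iff_AE) auto
    then show ?thesis by simp
  next
    case False
    then have n: "0 < n" using \<nu>_nonneg[of x t] by (simp add: n_def)
    have pw: "\<bar>b x - b y\<bar> * \<bar>f y\<bar> \<le> n * d + (d + 1) * n * (\<bar>f y\<bar> / n) powr s + n * \<bar>b y - mean x t\<bar> powr s'" for y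
    proof -
      define z where "z = \<bar>f y\<bar> / n"
      define w where "w = \<bar>b y - mean x t\<bar>"
      have z0: "0 \<le> z" and w0: "0 \<le> w" using n by (auto simp: z_def w_def)
      have z1: "z \<le> 1 + z powr s"
      proof (cases "z \<le> 1")
        case False
        then have "z \<le> z powr s" using powr_mono[of 1 s z] s by simp
        then show ?thesis by simp
      qed (use powr_ge_zero[of z s] in linarith)
      \<comment> \<open>Young's inequality with constants 1, by comparing w with z^(s-1), the point
        at which both powers agree.\<close>
      have wz: "w * z \<le> z powr s + w powr s'"
      proof (cases "w \<le> z powr (s - 1)")
        case True
        then have "w * z \<le> z powr (s - 1) * z powr 1" using z0 by (simp add: mult_right_mono)
        also have "\<dots> = z powr s" by (simp only: powr_add[symmetric]) simp
        finally show ?thesis using powr_ge_zero[of w s'] by linarith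
      next
        case False
        have "z = (z powr (s - 1)) powr (1 / (s - 1))" using z0 s by (simp add: powr_powr)
        also have "\<dots> \<le> w powr (1 / (s - 1))" using False s by (intro powr_mono2) auto
        finally have "w * z \<le> w powr 1 * w powr (1 / (s - 1))" using w0 by (simp add: mult_left_mono)
        also have "\<dots> = w powr s'" using s by (simp only: powr_add[symmetric]) (simp add: s'_def field_simps)
        finally show ?thesis using powr_ge_zero[of z s] by linarith
      qed
      have "\<bar>b x - b y\<bar> \<le> d + w" unfolding d_def w_def by linarith
      then have "\<bar>b x - b y\<bar> * z \<le> (d + w) * z" using z0 by (rule mult_right_mono)
      also have "\<dots> \<le> d * (1 + z powr s) + (z powr s + w powr s')"
        using wz mult_left_mono[OF z1 d0] by (simp add: distrib_right)
      finally have "n * (\<bar>b x - b y\<bar> * z) \<le> n * (d * (1 + z powr s) + (z powr s + w powr s'))"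
        using n by (intro mult_left_mono) auto
      also have "n * (\<bar>b x - b y\<bar> * z) = \<bar>b x - b y\<bar> * \<bar>f y\<bar>" using n by (simp add: z_def)
      finally show ?thesis unfolding z_def[symmetric] w_def[symmetric] by (simp only: algebra_simps)
    qed
    let ?c = "(d + 1) * n / n powr s"
    have c0: "0 \<le> ?c" using d0 n by simp
    have "?I \<le> (\<integral>\<^sup>+y. ennreal (n * d) * indicator (ball x t) y
        + (ennreal ?c * (ennreal (\<bar>f y\<bar> powr s) * indicator (ball x t) y)
        + ennreal n * (ennreal (\<bar>b y - mean x t\<bar> powr s') * indicator (ball x t) y)) \<partial>lebesgue)"
    proof (intro nn_integral_mono)
      fix y
      have "ennreal (\<bar>b x - b y\<bar> * \<bar>f y\<bar>) \<le> ennreal (n * d + (?c * \<bar>f y\<bar> powr s + n * \<bar>b y - mean x t\<bar> powr s'))"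
        using pw[of y] n by (intro ennreal_leI) (simp add: powr_divide)
      also have "\<dots> = ennreal (n * d) + (ennreal ?c * ennreal (\<bar>f y\<bar> powr s) + ennreal n * ennreal (\<bar>b y - mean x t\<bar> powr s'))"
        using c0 n d0 by (simp only: ennreal_plus ennreal_mult powr_ge_zero mult_nonneg_nonneg add_nonneg_nonneg less_imp_le)
      finally show "ennreal (\<bar>b x - b y\<bar> * \<bar>f y\<bar>) * indicator (ball x t) y
        \<le> ennreal (n * d) * indicator (ball x t) y
        + (ennreal ?c * (ennreal (\<bar>f y\<bar> powr s) * indicator (ball x t) y)
        + ennreal n * (ennreal (\<bar>b y - mean x t\<bar> powr s') * indicator (ball x t) y))"
        by (cases "y \<in> ball x t") simp_all
    qed
    also have "\<dots> = ennreal (n * d) * emeasure lebesgue (ball x t) + (ennreal ?c * mass x t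
        + ennreal n * (\<integral>\<^sup>+y\<in>ball x t. ennreal (\<bar>b y - mean x t\<bar> powr s') \<partial>lebesgue))"
      unfolding mass_def by (simp add: nn_integral_add nn_integral_cmult nn_integral_cmult_indicator)
    also have "\<dots> \<le> ennreal (n * d) * ennreal (vol x t) + (ennreal ?c * ennreal (n powr s * vol x t)
        + ennreal n * ennreal ((osc_const - 1) * vol x t))"
      unfolding emeasure_ball_eq mass_eq[OF t] n_def[symmetric]
      by (intro add_left_mono mult_left_mono mean_oscillation_powr t) auto
    also have "\<dots> = ennreal (n * d * vol x t + (?c * (n powr s * vol x t) + n * ((osc_const - 1) * vol x t)))"
      using c0 n d0 osc_const by (simp only: ennreal_plus ennreal_mult powr_ge_zero mult_nonneg_nonneg add_nonneg_nonneg less_imp_le measure_nonneg diff_ge_0_iff_ge)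
    also have "n * d * vol x t + (?c * (n powr s * vol x t) + n * ((osc_const - 1) * vol x t)) = (2 * d + osc_const) * (n * vol x t)"
      using n by (simp add: field_simps)
    finally show ?thesis .
  qed
  have "ennreal (vol x t powr (\<beta> - 1)) * ?I \<le> ennreal (vol x t powr (\<beta> - 1)) * ennreal ((2 * d + osc_const) * (n * vol x t))"
    using I by (rule mult_left_mono) simp
  also have "\<dots> = ennreal (vol x t powr (\<beta> - 1) * ((2 * d + osc_const) * (n * vol x t)))"
    using d0 osc_const \<nu>_nonneg[of x t] by (intro ennreal_mult[symmetric]) (auto simp: n_def)
  also have "vol x t powr (\<beta> - 1) * ((2 * d + osc_const) * (n * vol x t)) = (2 * d + osc_const) * ((vol x t powr (\<beta> - 1) * vol x t) * n)"
    by (simp only: mult_ac)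
  also have "vol x t powr (\<beta> - 1) * vol x t = vol x t powr \<beta>"
    using V powr_mult_base[of "vol x t" "\<beta> - 1"] by (simp only: less_imp_le mult.commute) (simp only: add_diff_cancel_left' diff_add_cancel add.commute[of 1])
  finally show ?thesis by (simp only: d_def n_def A_def)
qed

text \<open>The average is bounded by a real z with \<psi> z \<le> G x instead of inserting it into
  \<Psi>; this keeps infinite averages away and lets the supremum over t be taken later by
  monotonicity alone.\<close>

lemma comm_average_majorant:
  obtains G where "G \<in> borel_measurable lebesgue" "(\<integral>\<^sup>+x. G x \<partial>lebesgue) \<le> ennreal modular_const"
    "AE x in lebesgue. \<forall>t>0. \<exists>z\<ge>0.
       ennreal (vol x t powr (\<beta> - 1)) * (\<integral>\<^sup>+y\<in>ball x t. ennreal (\<bar>b x - b y\<bar> * \<bar>f y\<bar>) \<partial>lebesgue) \<le> ennreal z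
       \<and> ennreal (\<psi> z) \<le> G x"
proof -
  have "\<forall>k. \<exists>W. W \<in> borel_measurable lebesgue \<and>
    (\<integral>\<^sup>+x. W x \<partial>lebesgue) \<le> ennreal (2 * 5 ^ DIM('a) * tail_const) * (ennreal (\<psi> (2 powr of_int k) / lev k powr s) * (\<integral>\<^sup>+y. large_part (lev k) y \<partial>lebesgue)) \<and>
    (AE x in lebesgue. \<forall>t>0. 2 powr of_int k < A x t \<and> A x t \<le> 2 powr of_int (k + 1) \<longrightarrow>
       ennreal (\<psi> ((2 * \<bar>b x - mean x t\<bar> + osc_const) * A x t)) \<le> W x)"
  proof
    fix k
    obtain W where "W \<in> borel_measurable lebesgue"
      "(\<integral>\<^sup>+x. W x \<partial>lebesgue) \<le> ennreal (2 * 5 ^ DIM('a) * tail_const) * (ennreal (\<psi> (2 powr of_int k) / lev k powr s) * (\<integral>\<^sup>+y. large_part (lev k) y \<partial>lebesgue))"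
      "AE x in lebesgue. \<forall>t>0. 2 powr of_int k < A x t \<and> A x t \<le> 2 powr of_int (k + 1) \<longrightarrow>
         ennreal (\<psi> ((2 * \<bar>b x - mean x t\<bar> + osc_const) * A x t)) \<le> W x"
      by (rule level_majorant)
    then show "\<exists>W. W \<in> borel_measurable lebesgue \<and>
      (\<integral>\<^sup>+x. W x \<partial>lebesgue) \<le> ennreal (2 * 5 ^ DIM('a) * tail_const) * (ennreal (\<psi> (2 powr of_int k) / lev k powr s) * (\<integral>\<^sup>+y. large_part (lev k) y \<partial>lebesgue)) \<and>
      (AE x in lebesgue. \<forall>t>0. 2 powr of_int k < A x t \<and> A x t \<le> 2 powr of_int (k + 1) \<longrightarrow>
       ennreal (\<psi> ((2 * \<bar>b x - mean x t\<bar> + osc_const) * A x t)) \<le> W x)"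
      by (intro exI[of _ W] conjI)
  qed
  from choice[OF this] obtain W where W: "\<And>k. W k \<in> borel_measurable lebesgue"
    "\<And>k. (\<integral>\<^sup>+x. W k x \<partial>lebesgue) \<le> ennreal (2 * 5 ^ DIM('a) * tail_const) * (ennreal (\<psi> (2 powr of_int k) / lev k powr s) * (\<integral>\<^sup>+y. large_part (lev k) y \<partial>lebesgue))"
    "\<And>k. AE x in lebesgue. \<forall>t>0. 2 powr of_int k < A x t \<and> A x t \<le> 2 powr of_int (k + 1) \<longrightarrow>
         ennreal (\<psi> ((2 * \<bar>b x - mean x t\<bar> + osc_const) * A x t)) \<le> W k x"
    by blast
  define G where "G x = (\<integral>\<^sup>+k. W k x \<partial>count_space UNIV)" for x
  have 1: "G \<in> borel_measurable lebesgue"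
    unfolding G_def using W(1) by (intro borel_measurable_nn_integral_count_space) auto
  have "(\<integral>\<^sup>+x. G x \<partial>lebesgue) = (\<integral>\<^sup>+k. \<integral>\<^sup>+x. W k x \<partial>lebesgue \<partial>count_space UNIV)"
    unfolding G_def using W(1) by (intro nn_integral_count_space_nn_integral) auto
  also have "\<dots> \<le> (\<integral>\<^sup>+k. ennreal (2 * 5 ^ DIM('a) * tail_const) * (\<integral>\<^sup>+x. ennreal (\<psi> (2 powr of_int k) / lev k powr s) * large_part (lev k) x \<partial>lebesgue) \<partial>count_space UNIV)"
    using W(2) by (intro nn_integral_mono) (simp add: nn_integral_cmult)
  also have "\<dots> = ennreal (2 * 5 ^ DIM('a) * tail_const) * (\<integral>\<^sup>+k. \<integral>\<^sup>+x. ennreal (\<psi> (2 powr of_int k) / lev k powr s) * large_part (lev k) x \<partial>lebesgue \<partial>count_space UNIV)"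
    by (rule nn_integral_cmult) simp
  also have "(\<integral>\<^sup>+k. \<integral>\<^sup>+x. ennreal (\<psi> (2 powr of_int k) / lev k powr s) * large_part (lev k) x \<partial>lebesgue \<partial>count_space UNIV)
     = (\<integral>\<^sup>+x. \<integral>\<^sup>+k. ennreal (\<psi> (2 powr of_int k) / lev k powr s) * large_part (lev k) x \<partial>count_space UNIV \<partial>lebesgue)"
    by (intro nn_integral_count_space_nn_integral[symmetric]) auto
  also have "\<dots> \<le> (\<integral>\<^sup>+x. ennreal sum_const * ennreal (\<phi> \<bar>f x\<bar>) \<partial>lebesgue)"
    by (intro nn_integral_mono level_sum)
  also have "\<dots> = ennreal sum_const * (\<integral>\<^sup>+x. ennreal (\<phi> \<bar>f x\<bar>) \<partial>lebesgue)"
    by (rule nn_integral_cmult) measurable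
  also have "\<dots> \<le> ennreal sum_const * 1"
    using modular by (rule mult_left_mono) simp
  finally have "(\<integral>\<^sup>+x. G x \<partial>lebesgue) \<le> ennreal (2 * 5 ^ DIM('a) * tail_const) * (ennreal sum_const * 1)"
    by (simp add: mult_left_mono)
  also have "\<dots> = ennreal modular_const"
    using tail_const sum_const by (simp only: mult_1_right modular_const_def) (simp add: ennreal_mult)
  finally have 2: "(\<integral>\<^sup>+x. G x \<partial>lebesgue) \<le> ennreal modular_const" .
  have "AE x in lebesgue. \<forall>k::int. \<forall>t>0. 2 powr of_int k < A x t \<and> A x t \<le> 2 powr of_int (k + 1) \<longrightarrow>
         ennreal (\<psi> ((2 * \<bar>b x - mean x t\<bar> + osc_const) * A x t)) \<le> W k x"
    unfolding AE_all_countable by (intro allI W(3))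
  then have 3: "AE x in lebesgue. \<forall>t>0. \<exists>z\<ge>0.
       ennreal (vol x t powr (\<beta> - 1)) * (\<integral>\<^sup>+y\<in>ball x t. ennreal (\<bar>b x - b y\<bar> * \<bar>f y\<bar>) \<partial>lebesgue) \<le> ennreal z
       \<and> ennreal (\<psi> z) \<le> G x"
  proof (rule eventually_mono, intro allI impI)
    fix x t
    assume x: "\<forall>k::int. \<forall>t>0. 2 powr of_int k < A x t \<and> A x t \<le> 2 powr of_int (k + 1) \<longrightarrow>
         ennreal (\<psi> ((2 * \<bar>b x - mean x t\<bar> + osc_const) * A x t)) \<le> W k x" and t: "0 < (t::real)"
    let ?z = "(2 * \<bar>b x - mean x t\<bar> + osc_const) * A x t"
    have A0: "0 \<le> A x t" by (simp add: A_def \<nu>_nonneg)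
    have z0: "0 \<le> ?z" using A0 osc_const by simp
    have "ennreal (\<psi> ?z) \<le> G x"
    \<comment> \<open>The value 0 lies in no dyadic level; there z = 0 and \<psi> vanishes.\<close>
    proof (cases "A x t = 0")
      case False
      then have A1: "0 < A x t" using A0 by simp
      define k where "k = \<lceil>log 2 (A x t)\<rceil> - 1"
      have "of_int k < log 2 (A x t)" "log 2 (A x t) \<le> of_int (k + 1)" unfolding k_def by linarith+
      then have "2 powr of_int k < A x t" "A x t \<le> 2 powr of_int (k + 1)"
        using A1 by (simp_all only: less_log_iff log_le_iff one_less_numeral_iff semiring_norm)
      then have "ennreal (\<psi> ?z) \<le> W k x" using x t by blast
      also have "\<dots> \<le> G x" unfolding G_def by (rule nn_integral_ge_point) simp
      finally show ?thesis .
    qed simp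
    then show "\<exists>z\<ge>0. ennreal (vol x t powr (\<beta> - 1)) * (\<integral>\<^sup>+y\<in>ball x t. ennreal (\<bar>b x - b y\<bar> * \<bar>f y\<bar>) \<partial>lebesgue) \<le> ennreal z
       \<and> ennreal (\<psi> z) \<le> G x"
      using z0 comm_average_le[OF t] by (intro exI[of _ ?z] conjI)
  qed
  show ?thesis by (rule that[OF 1 2 3])
qed

end

section \<open>Measurability and the norm inequality\<close>

text \<open>Completeness: the preimages differ only inside a null set, all of whose subsets are
  measurable.\<close>

lemma borel_measurable_lebesgue_AE_cong:
  assumes f: "f \<in> borel_measurable lebesgue" and ae: "AE x in lebesgue. f x = g x"
  shows "g \<in> borel_measurable lebesgue"
proof (rule measurableI)
  fix B :: "'b set" assume B: "B \<in> sets borel"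
  obtain N where N: "N \<in> null_sets lebesgue" "\<And>x. x \<notin> N \<Longrightarrow> f x = g x"
    using ae unfolding completion.AE_iff_null_sets by auto
  have "g -` B \<inter> space lebesgue = (f -` B \<inter> space lebesgue - N) \<union> (g -` B \<inter> N)"
    using N(2) by auto
  moreover have "f -` B \<inter> space lebesgue - N \<in> sets lebesgue"
    using f B N(1) by (intro sets.Diff measurable_sets) auto
  moreover have "g -` B \<inter> N \<in> sets lebesgue"
    by (rule completion.complete[OF _ N(1)]) auto
  ultimately show "g -` B \<inter> space lebesgue \<in> sets lebesgue" by (simp only: sets.Un)
qed auto

text \<open>By monotone convergence the integral over \<open>ball x t\<close> is the limit of those
  over balls of radius r < t. For rational u between r and t it can only grow on passing from r to
  u, and so does the weight on passing from t to u, as \<alpha> < n makes its exponent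
  negative.\<close>

lemma frac_max_comm_rational:
  fixes b f :: "'a::euclidean_space \<Rightarrow> real"
  assumes [measurable]: "b \<in> borel_measurable lebesgue" "f \<in> borel_measurable lebesgue"
    and \<alpha>: "\<alpha> < real DIM('a)"
  shows "frac_max_comm b \<alpha> f x = (SUP t\<in>{0<..} \<inter> \<rat>.
        ennreal (measure lebesgue (ball x t) powr (\<alpha> / real DIM('a) - 1))
        * (\<integral>\<^sup>+ y\<in>ball x t. ennreal (\<bar>b x - b y\<bar> * \<bar>f y\<bar>) \<partial>lebesgue))"
    (is "_ = (SUP t\<in>_. ?c t * ?I t)")
proof -
  have "(SUP t\<in>{0<..}. ?c t * ?I t) \<le> (SUP t\<in>{0<..} \<inter> \<rat>. ?c t * ?I t)"
  proof (rule SUP_least)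
    fix t :: real assume "t \<in> {0<..}"
    then have t: "0 < t" by simp
    \<comment> \<open>With i + 2 in the denominator the radius is positive already for i =
      0.\<close>
    let ?r = "\<lambda>i::nat. t * (1 - 1 / real (i + 2))"
    have r: "0 < ?r i" "?r i < t" for i
    proof -
      have "0 < 1 / real (i + 2)" "1 / real (i + 2) < 1" by simp_all
      then have u: "0 < 1 - 1 / real (i + 2)" "1 - 1 / real (i + 2) < 1" by linarith+
      show "0 < ?r i" using t u(1) by (rule mult_pos_pos)
      show "?r i < t" using mult_strict_left_mono[OF u(2) t] by simp
    qed
    have inc: "ball x (?r i) \<subseteq> ball x (?r j)" if "i \<le> j" for i j
      using that t by (intro subset_ball mult_left_mono) (auto simp: field_simps)
    have un: "ball x t = (\<Union>i. ball x (?r i))"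
    proof
      show "ball x t \<subseteq> (\<Union>i. ball x (?r i))"
      proof
        fix y assume "y \<in> ball x t"
        then have "0 < 1 - dist x y / t" using t by simp
        then obtain i where "1 / real (Suc i) < 1 - dist x y / t" using nat_approx_posE by blast
        moreover have "1 / real (i + 2) \<le> 1 / real (Suc i)" by (intro divide_left_mono) auto
        ultimately have "dist x y / t < 1 - 1 / real (i + 2)" by linarith
        then have "dist x y < ?r i" using t by (simp add: pos_divide_less_eq mult.commute)
        then show "y \<in> (\<Union>i. ball x (?r i))" by auto
      qed
      show "(\<Union>i. ball x (?r i)) \<subseteq> ball x t"
        by (intro UN_least subset_ball less_imp_le r(2))
    qed
    have I: "?I t = (SUP i. ?I (?r i))"
    proof -
      have "?I t = (\<integral>\<^sup>+ y. (SUP i. ennreal (\<bar>b x - b y\<bar> * \<bar>f y\<bar>) * indicator (ball x (?r i)) y) \<partial>lebesgue)"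
      proof (rule nn_integral_cong)
        fix y
        show "ennreal (\<bar>b x - b y\<bar> * \<bar>f y\<bar>) * indicator (ball x t) y
          = (SUP i. ennreal (\<bar>b x - b y\<bar> * \<bar>f y\<bar>) * indicator (ball x (?r i)) y)"
        proof (rule antisym)
          show "ennreal (\<bar>b x - b y\<bar> * \<bar>f y\<bar>) * indicator (ball x t) y
            \<le> (SUP i. ennreal (\<bar>b x - b y\<bar> * \<bar>f y\<bar>) * indicator (ball x (?r i)) y)"
          proof (cases "y \<in> ball x t")
            case True
            then obtain i where "y \<in> ball x (?r i)" unfolding un by blast
            then show ?thesis using True by (intro SUP_upper2[of i]) (simp_all only: UNIV_I indicator_simps order_refl)
          qed simp
          show "(SUP i. ennreal (\<bar>b x - b y\<bar> * \<bar>f y\<bar>) * indicator (ball x (?r i)) y)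
            \<le> ennreal (\<bar>b x - b y\<bar> * \<bar>f y\<bar>) * indicator (ball x t) y"
          proof (intro SUP_least mult_left_mono)
            fix i
            have "ball x (?r i) \<subseteq> ball x t" by (intro subset_ball less_imp_le r(2))
            then show "indicator (ball x (?r i)) y \<le> (indicator (ball x t) y :: ennreal)"
              by (rule indicator_leI[OF subsetD])
          qed simp
        qed
      qed
      also have "\<dots> = (SUP i. ?I (?r i))"
      proof (rule nn_integral_monotone_convergence_SUP)
        show "incseq (\<lambda>i y. ennreal (\<bar>b x - b y\<bar> * \<bar>f y\<bar>) * indicator (ball x (?r i)) y)"
          unfolding incseq_def le_fun_def
          by (intro allI impI mult_left_mono indicator_leI[OF subsetD[OF inc]]) auto
      qed measurable
      finally show ?thesis .
    qed
    show "?c t * ?I t \<le> (SUP t\<in>{0<..} \<inter> \<rat>. ?c t * ?I t)"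
      unfolding I SUP_mult_left_ennreal
    proof (rule SUP_least)
      fix i
      obtain u where u: "u \<in> \<rat>" "?r i < u" "u < t" using Rats_dense_in_real[OF r(2)] by blast
      have u0: "0 < u" using u r(1)[of i] by linarith
      have "measure lebesgue (ball x u) \<le> measure lebesgue (ball x t)"
        using u by (intro measure_mono_fmeasurable subset_ball) auto
      then have "?c t \<le> ?c u"
        using \<alpha> measure_ball_pos[OF u0, of x] by (intro ennreal_leI powr_mono2') (auto simp: field_simps)
      moreover have "?I (?r i) \<le> ?I u" using u by (intro nn_set_integral_set_mono subset_ball) auto
      ultimately have "?c t * ?I (?r i) \<le> ?c u * ?I u" by (rule mult_mono) auto
      also have "\<dots> \<le> (SUP t\<in>{0<..} \<inter> \<rat>. ?c t * ?I t)"
        using u u0 by (intro SUP_upper) auto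
      finally show "?c t * ?I (?r i) \<le> (SUP t\<in>{0<..} \<inter> \<rat>. ?c t * ?I t)" .
    qed
  qed
  moreover have "(SUP t\<in>{0<..} \<inter> \<rat>. ?c t * ?I t) \<le> (SUP t\<in>{0<..}. ?c t * ?I t)"
    by (rule SUP_subset_mono) auto
  ultimately show ?thesis unfolding frac_max_comm_def by (rule antisym)
qed

text \<open>Measurability of a parameter integral needs a jointly measurable integrand, so
  \<open>b\<close> and \<open>f\<close> are replaced by Borel representatives. Under the integral
  this changes nothing; at the point x it matters only for x in a null set.\<close>

lemma frac_max_comm_measurable:
  fixes b f :: "'a::euclidean_space \<Rightarrow> real"
  assumes b: "b \<in> borel_measurable lebesgue" and f: "f \<in> borel_measurable lebesgue"
    and \<alpha>: "\<alpha> < real DIM('a)"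
  shows "frac_max_comm b \<alpha> f \<in> borel_measurable lebesgue"
proof -
  obtain b' where b'[measurable]: "b' \<in> borel_measurable lborel" and bb: "AE x in lborel. b x = b' x"
    using completion_ex_borel_measurable_real[OF b] by blast
  obtain f' where f'[measurable]: "f' \<in> borel_measurable lborel" and ff: "AE x in lborel. f x = f' x"
    using completion_ex_borel_measurable_real[OF f] by blast
  define v where "v t = measure lebesgue (ball (0::'a) t)" for t
  have v: "measure lebesgue (ball x t) = v t" if "0 < t" for x :: 'a and t
    using measure_ball_scale[OF less_imp_le[OF that] zero_le_one, of x 0] unfolding v_def power_one mult_1_left .
  \<comment> \<open>The moving ball becomes an open subset of the product space, which makes its
    indicator jointly measurable.\<close>
  define J where "J t x = (\<integral>\<^sup>+ y. ennreal (\<bar>b' x - b' y\<bar> * \<bar>f' y\<bar>) * indicator {p. dist (fst p) (snd p) < t} (x, y) \<partial>lborel)" for t x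
  have [measurable]: "{p :: 'a \<times> 'a. dist (fst p) (snd p) < t} \<in> sets (borel \<Otimes>\<^sub>M borel)" for t
    unfolding borel_prod by (intro borel_open open_Collect_less continuous_intros)
  have Jm: "J t \<in> borel_measurable lborel" for t
    unfolding J_def
  proof (rule lborel.borel_measurable_nn_integral)
    have [measurable]: "b' \<in> borel_measurable borel" "f' \<in> borel_measurable borel" using b' f' by simp_all
    have "(\<lambda>p. ennreal (\<bar>b' (fst p) - b' (snd p)\<bar> * \<bar>f' (snd p)\<bar>) * indicator {p. dist (fst p) (snd p) < t} p)
      \<in> borel_measurable (borel \<Otimes>\<^sub>M borel)"
      by measurable
    then show "case_prod (\<lambda>x y. ennreal (\<bar>b' x - b' y\<bar> * \<bar>f' y\<bar>) * indicator {p. dist (fst p) (snd p) < t} (x, y))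
      \<in> borel_measurable (lborel \<Otimes>\<^sub>M lborel)"
      by (subst measurable_cong_sets[OF sets_pair_measure_cong[OF sets_lborel sets_lborel] refl]) (simp add: case_prod_beta')
  qed
  define M where "M x = (SUP t\<in>{0<..} \<inter> \<rat>. ennreal (v t powr (\<alpha> / real DIM('a) - 1)) * J t x)" for x
  have "M \<in> borel_measurable lborel"
    unfolding M_def
  proof (rule borel_measurable_SUP)
    show "countable ({0<..} \<inter> \<rat> :: real set)" by (intro countable_Int2 countable_rat)
    show "(\<lambda>x. ennreal (v t powr (\<alpha> / real DIM('a) - 1)) * J t x) \<in> borel_measurable lborel" for t
      using Jm by measurable
  qed
  then have Mm: "M \<in> borel_measurable lebesgue" by (rule measurable_completion)
  have "AE x in lebesgue. b x = b' x" using bb by (rule AE_completion)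
  then have "AE x in lebesgue. M x = frac_max_comm b \<alpha> f x"
  proof (rule eventually_mono)
    fix x assume x: "b x = b' x"
    have "(\<integral>\<^sup>+ y\<in>ball x t. ennreal (\<bar>b x - b y\<bar> * \<bar>f y\<bar>) \<partial>lebesgue) = J t x" for t
    proof -
      have "(\<integral>\<^sup>+ y\<in>ball x t. ennreal (\<bar>b x - b y\<bar> * \<bar>f y\<bar>) \<partial>lebesgue) = (\<integral>\<^sup>+ y\<in>ball x t. ennreal (\<bar>b x - b y\<bar> * \<bar>f y\<bar>) \<partial>lborel)"
        by (rule nn_integral_completion)
      also have "\<dots> = J t x"
        unfolding J_def x
      proof (rule nn_integral_cong_AE)
        show "AE y in lborel. ennreal (\<bar>b' x - b y\<bar> * \<bar>f y\<bar>) * indicator (ball x t) y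
           = ennreal (\<bar>b' x - b' y\<bar> * \<bar>f' y\<bar>) * indicator {p. dist (fst p) (snd p) < t} (x, y)"
          using bb ff by eventually_elim (simp split: split_indicator)
      qed
      finally show ?thesis .
    qed
    then show "M x = frac_max_comm b \<alpha> f x"
      unfolding frac_max_comm_rational[OF b f \<alpha>] M_def by (intro SUP_cong) (simp_all add: v del: measure_completion)
  qed
  with Mm show ?thesis by (rule borel_measurable_lebesgue_AE_cong)
qed

text \<open>The supremum is finite because \<phi> is unbounded. If it is \<sigma> > 0, some v i
  exceeds \<sigma>/2, so \<phi>(\<sigma>/2) \<le> G by monotonicity; this costs the factor 2. The
  division by C turns into the factor 1/C by convexity.\<close>

lemma (in doubling_convex) young_ext_SUP_le:
  assumes \<Phi>: "\<And>t. 0 \<le> t \<Longrightarrow> \<Phi> t = ennreal (\<phi> t)" and C: "1 \<le> C"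
    and v: "\<And>i. i \<in> I \<Longrightarrow> \<exists>z\<ge>0. v i \<le> ennreal z \<and> ennreal (\<phi> z) \<le> G"
  shows "young_ext \<Phi> ((SUP i\<in>I. v i) / ennreal (2 * C)) \<le> ennreal (1 / C) * G"
proof (cases G)
  case top
  then show ?thesis using C by (simp add: ennreal_mult_top)
next
  case (real g)
  have v': "\<phi> y \<le> g" if "0 \<le> y" "i \<in> I" "ennreal y < v i" for y i
  proof -
    obtain z where z: "0 \<le> z" "v i \<le> ennreal z" "ennreal (\<phi> z) \<le> G" using v[OF \<open>i \<in> I\<close>] by blast
    from that(3) z(2) have "ennreal y < ennreal z" by (rule less_le_trans)
    then have "y < z" using that z by (simp add: ennreal_less_iff)
    then have "\<phi> y \<le> \<phi> z" using that by (intro mono) auto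
    also have "\<phi> z \<le> g" using z real by (simp add: ennreal_le_iff)
    finally show ?thesis .
  qed
  have "(SUP i\<in>I. v i) \<noteq> \<infinity>"
  proof
    assume top: "(SUP i\<in>I. v i) = \<infinity>"
    obtain y where y: "0 < y" "\<phi> y = g + 1" using surj[of "g + 1"] real(1) by auto
    have "ennreal y < (SUP i\<in>I. v i)" unfolding top by simp
    then obtain i where "i \<in> I" "ennreal y < v i" by (auto simp: less_SUP_iff)
    then show False using v'[of y i] y by simp
  qed
  then obtain \<sigma> where \<sigma>: "0 \<le> \<sigma>" "(SUP i\<in>I. v i) = ennreal \<sigma>" by (cases "SUP i\<in>I. v i") auto
  have half: "\<phi> (\<sigma> / 2) \<le> g"
  proof (cases "\<sigma> = 0")
    case False
    then have "ennreal (\<sigma> / 2) < (SUP i\<in>I. v i)" unfolding \<sigma>(2) using \<sigma>(1) by (intro ennreal_lessI) auto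
    then obtain i where "i \<in> I" "ennreal (\<sigma> / 2) < v i" by (auto simp: less_SUP_iff)
    then show ?thesis using v'[of "\<sigma> / 2" i] \<sigma>(1) by simp
  qed (use real(1) in simp)
  have "young_ext \<Phi> ((SUP i\<in>I. v i) / ennreal (2 * C)) = ennreal (\<phi> (1 / C * (\<sigma> / 2)))"
    unfolding \<sigma>(2) young_ext_def using C \<sigma>(1) \<Phi>[of "\<sigma> / (2 * C)"] by (simp add: divide_ennreal mult.commute)
  also have "\<dots> \<le> ennreal (1 / C * g)"
  proof (rule ennreal_leI)
    have "\<phi> (1 / C * (\<sigma> / 2)) \<le> 1 / C * \<phi> (\<sigma> / 2)" using C \<sigma>(1) by (intro contract) auto
    also have "\<dots> \<le> 1 / C * g" using half C by (intro mult_left_mono) auto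
    finally show "\<phi> (1 / C * (\<sigma> / 2)) \<le> 1 / C * g" .
  qed
  also have "\<dots> = ennreal (1 / C) * G" using C real by (simp only: ennreal_mult zero_le_divide_1_iff order_trans[OF zero_le_one])
  finally show ?thesis .
qed

theorem theorem5p12:
  fixes \<alpha> :: real and b :: "'a::euclidean_space \<Rightarrow> real"
    and \<Phi> \<Psi> :: "real \<Rightarrow> ennreal"
  assumes "0 \<le> \<alpha>" and "\<alpha> < real DIM('a)"
    and "b \<in> BMO"
    and "young_function \<Phi>" and "young_function \<Psi>"
    and "\<forall>t>0. young_inv \<Psi> t = young_inv \<Phi> t * t powr (- \<alpha> / real DIM('a))"
    and "1 < lower_index \<Phi>" and "lower_index \<Phi> \<le> upper_index \<Phi>" and "upper_index \<Phi> < \<infinity>"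
    and "1 < lower_index \<Psi>" and "lower_index \<Psi> \<le> upper_index \<Psi>" and "upper_index \<Psi> < \<infinity>"
  shows "\<exists>C\<ge>0. \<forall>f \<in> orlicz_space \<Phi>.
           frac_max_comm b \<alpha> f \<in> borel_measurable lebesgue
         \<and> luxemburg_norm \<Psi> (frac_max_comm b \<alpha> f)
             \<le> ennreal C * luxemburg_norm \<Phi> (\<lambda>x. ennreal \<bar>f x\<bar>)"
proof -
  define \<phi> where "\<phi> t = enn2real (\<Phi> t)" for t
  define \<psi> where "\<psi> t = enn2real (\<Psi> t)" for t
  define \<beta> where "\<beta> = \<alpha> / real DIM('a)"
  obtain D\<phi> p where p: "1 < p" and \<phi>: "doubling_convex \<phi> D\<phi>"
    and \<Phi>: "\<And>t. 0 \<le> t \<Longrightarrow> \<Phi> t = ennreal (\<phi> t)"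
    and lower: "\<And>t. 0 < t \<Longrightarrow> 2 powr p * \<phi> t \<le> \<phi> (2 * t)"
    using young_regular[OF assms(4,7,9)] unfolding \<phi>_def by metis
  obtain D\<psi> where \<psi>: "doubling_convex \<psi> D\<psi>" and \<Psi>: "\<And>t. 0 \<le> t \<Longrightarrow> \<Psi> t = ennreal (\<psi> t)"
    using young_regular[OF assms(5,10,12)] unfolding \<psi>_def by metis
  interpret phi: doubling_convex \<phi> D\<phi> by fact
  interpret psi: doubling_convex \<psi> D\<psi> by fact
  have inv\<Phi>: "young_inv \<Phi> (\<phi> t) = t" if "0 < t" for t
    using young_inv_eq[of \<Phi> D\<phi> t] \<phi> \<Phi> that unfolding \<phi>_def by simp
  have inv\<Psi>: "young_inv \<Psi> (\<psi> t) = t" if "0 < t" for t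
    using young_inv_eq[of \<Psi> D\<psi> t] \<psi> \<Psi> that unfolding \<psi>_def by simp
  have rel: "\<phi> (v * \<psi> v powr \<beta>) = \<psi> v" if v: "0 < v" for v
  proof -
    have pv: "0 < \<psi> v" by (rule psi.pos) fact
    \<comment> \<open>Now v and u are the \<Psi>- and \<Phi>-inverses of the same value \<psi> v, to
      which the hypothesis on the inverses applies.\<close>
    obtain u where u: "0 < u" "\<phi> u = \<psi> v" using phi.surj[OF pv] .
    have "v = u * \<psi> v powr (- \<alpha> / real DIM('a))"
      using assms(6)[rule_format, OF pv] inv\<Psi>[OF v] inv\<Phi>[OF u(1)] u(2) by simp
    then have "v * \<psi> v powr \<beta> = u * (\<psi> v powr (- \<beta>) * \<psi> v powr \<beta>)" by (simp add: \<beta>_def)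
    also have "\<psi> v powr (- \<beta>) * \<psi> v powr \<beta> = 1" using pv by (simp add: powr_add[symmetric])
    finally show ?thesis using u by simp
  qed
  obtain K where "bmo_fun b K" using BMO_imp_bmo_fun[OF assms(3)] .
  then interpret bmo_fun b K .
  interpret comm_orlicz b K \<phi> D\<phi> \<psi> D\<psi> \<beta> p
    by unfold_locales (use p lower rel assms(1) in \<open>auto simp: \<beta>_def\<close>)
  \<comment> \<open>Dividing by C brings the modular below 1; C \<ge> 1 is what the convexity step
    requires.\<close>
  define C where "C = max 1 modular_const"
  have C: "1 \<le> C" "modular_const \<le> C" by (auto simp: C_def)
  \<comment> \<open>Every admissible l is treated, so the infimum in the norm need not be attained
    and may be 0.\<close>
  have key: "luxemburg_norm \<Psi> (frac_max_comm b \<alpha> f) \<le> ennreal (2 * C) * ennreal l"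
    if f[measurable]: "f \<in> borel_measurable lebesgue" and l: "0 < l"
      and le1: "(\<integral>\<^sup>+ x. young_ext \<Phi> (ennreal \<bar>f x\<bar> / ennreal l) \<partial>lebesgue) \<le> 1" for f :: "'a \<Rightarrow> real" and l
  proof -
    define g where "g x = f x / l" for x
    have [measurable]: "g \<in> borel_measurable lebesgue" unfolding g_def by measurable
    have "(\<integral>\<^sup>+ x. ennreal (\<phi> \<bar>g x\<bar>) \<partial>lebesgue) = (\<integral>\<^sup>+ x. young_ext \<Phi> (ennreal \<bar>f x\<bar> / ennreal l) \<partial>lebesgue)"
      using l \<Phi> by (intro nn_integral_cong) (simp add: g_def young_ext_def divide_ennreal)
    then interpret normalized_orlicz b K \<phi> D\<phi> \<psi> D\<psi> \<beta> p g
      by unfold_locales (use le1 in auto)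
    obtain G where G: "G \<in> borel_measurable lebesgue" "(\<integral>\<^sup>+x. G x \<partial>lebesgue) \<le> ennreal modular_const"
      "AE x in lebesgue. \<forall>t>0. \<exists>z\<ge>0.
       ennreal (vol x t powr (\<beta> - 1)) * (\<integral>\<^sup>+y\<in>ball x t. ennreal (\<bar>b x - b y\<bar> * \<bar>g y\<bar>) \<partial>lebesgue) \<le> ennreal z
       \<and> ennreal (\<psi> z) \<le> G x"
      by (rule comm_average_majorant)
    have scale: "frac_max_comm b \<alpha> f x = ennreal l * frac_max_comm b \<alpha> g x" for x
    proof -
      have "(\<integral>\<^sup>+y\<in>ball x t. ennreal (\<bar>b x - b y\<bar> * \<bar>f y\<bar>) \<partial>lebesgue)
          = ennreal l * (\<integral>\<^sup>+y\<in>ball x t. ennreal (\<bar>b x - b y\<bar> * \<bar>g y\<bar>) \<partial>lebesgue)" for t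
      proof (subst nn_integral_cmult[symmetric])
        show "(\<integral>\<^sup>+y\<in>ball x t. ennreal (\<bar>b x - b y\<bar> * \<bar>f y\<bar>) \<partial>lebesgue)
          = (\<integral>\<^sup>+y. ennreal l * (ennreal (\<bar>b x - b y\<bar> * \<bar>g y\<bar>) * indicator (ball x t) y) \<partial>lebesgue)"
        proof (rule nn_integral_cong)
          fix y
          have "ennreal (\<bar>b x - b y\<bar> * \<bar>f y\<bar>) = ennreal l * ennreal (\<bar>b x - b y\<bar> * \<bar>g y\<bar>)"
            using l by (subst ennreal_mult[symmetric]) (auto simp: g_def)
          then show "ennreal (\<bar>b x - b y\<bar> * \<bar>f y\<bar>) * indicator (ball x t) y
            = ennreal l * (ennreal (\<bar>b x - b y\<bar> * \<bar>g y\<bar>) * indicator (ball x t) y)"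
            by (simp only: mult.assoc)
        qed
      qed measurable
      then show ?thesis
        unfolding frac_max_comm_def SUP_mult_left_ennreal by (intro SUP_cong) (simp_all only: mult.left_commute)
    qed
    have "(\<integral>\<^sup>+ x. young_ext \<Psi> (frac_max_comm b \<alpha> f x / ennreal (2 * C * l)) \<partial>lebesgue)
        \<le> (\<integral>\<^sup>+ x. ennreal (1 / C) * G x \<partial>lebesgue)"
    proof (rule nn_integral_mono_AE, use G(3) in \<open>rule eventually_mono\<close>)
      fix x
      assume x: "\<forall>t>0. \<exists>z\<ge>0.
       ennreal (vol x t powr (\<beta> - 1)) * (\<integral>\<^sup>+y\<in>ball x t. ennreal (\<bar>b x - b y\<bar> * \<bar>g y\<bar>) \<partial>lebesgue) \<le> ennreal z
       \<and> ennreal (\<psi> z) \<le> G x"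
      have "frac_max_comm b \<alpha> f x / ennreal (2 * C * l) = frac_max_comm b \<alpha> g x / ennreal (2 * C)"
      proof -
        have "ennreal (2 * C * l) = ennreal l * ennreal (2 * C)" using l C by (simp add: ennreal_mult[symmetric] mult.commute)
        moreover have "ennreal l * inverse (ennreal l) = 1"
          using l by (simp add: ennreal_divide_self flip: divide_ennreal_def)
        ultimately show ?thesis unfolding scale using l C
          by (simp add: divide_ennreal_def ennreal_inverse_mult mult.assoc mult.left_commute)
            (simp flip: mult.assoc)
      qed
      also have "young_ext \<Psi> \<dots> \<le> ennreal (1 / C) * G x"
        unfolding frac_max_comm_def using x unfolding \<beta>_def[symmetric]
        by (intro psi.young_ext_SUP_le[OF \<Psi> C(1)]) auto
      finally show "young_ext \<Psi> (frac_max_comm b \<alpha> f x / ennreal (2 * C * l)) \<le> ennreal (1 / C) * G x" .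
    qed
    also have "\<dots> = ennreal (1 / C) * (\<integral>\<^sup>+ x. G x \<partial>lebesgue)" by (rule nn_integral_cmult) fact
    also have "\<dots> \<le> ennreal (1 / C) * ennreal C"
      using G(2) C(2) by (intro mult_left_mono order_trans[OF G(2)] ennreal_leI) auto
    also have "\<dots> = 1" using C by (subst ennreal_mult[symmetric]) auto
    finally have "luxemburg_norm \<Psi> (frac_max_comm b \<alpha> f) \<le> ennreal (2 * C * l)"
      unfolding luxemburg_norm_def using C l by (intro Inf_lower) auto
    then show ?thesis using C l by (simp add: ennreal_mult)
  qed
  have "frac_max_comm b \<alpha> f \<in> borel_measurable lebesgue
         \<and> luxemburg_norm \<Psi> (frac_max_comm b \<alpha> f)
             \<le> ennreal (2 * C) * luxemburg_norm \<Phi> (\<lambda>x. ennreal \<bar>f x\<bar>)" if "f \<in> orlicz_space \<Phi>" for f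
  proof
    have f: "f \<in> borel_measurable lebesgue" using that by (simp add: orlicz_space_def)
    show "frac_max_comm b \<alpha> f \<in> borel_measurable lebesgue"
      by (rule frac_max_comm_measurable) (use meas f assms(2) in auto)
    \<comment> \<open>The constant is moved to the left so that the claim is a lower bound for all
      admissible l and passes to their infimum.\<close>
    have "luxemburg_norm \<Psi> (frac_max_comm b \<alpha> f) / ennreal (2 * C) \<le> luxemburg_norm \<Phi> (\<lambda>x. ennreal \<bar>f x\<bar>)"
      unfolding luxemburg_norm_def[of \<Phi>]
    proof (rule Inf_greatest, clarify)
      fix l assume "0 < l" "(\<integral>\<^sup>+ x. young_ext \<Phi> (ennreal \<bar>f x\<bar> / ennreal l) \<partial>lebesgue) \<le> 1"
      from key[OF f this] show "luxemburg_norm \<Psi> (frac_max_comm b \<alpha> f) / ennreal (2 * C) \<le> ennreal l"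
        using C by (intro divide_le_posI_ennreal) (auto simp: mult.commute)
    qed
    then have "luxemburg_norm \<Psi> (frac_max_comm b \<alpha> f) / ennreal (2 * C) * ennreal (2 * C) \<le> luxemburg_norm \<Phi> (\<lambda>x. ennreal \<bar>f x\<bar>) * ennreal (2 * C)"
      by (rule mult_right_mono) simp
    then show "luxemburg_norm \<Psi> (frac_max_comm b \<alpha> f) \<le> ennreal (2 * C) * luxemburg_norm \<Phi> (\<lambda>x. ennreal \<bar>f x\<bar>)"
      using C by (subst (asm) ennreal_divide_times) (simp add: ennreal_divide_self mult.commute)
  qed
  then show ?thesis using C by (intro exI[of _ "2 * C"]) auto
qed

end
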